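(* Let $r,s$ be positive integers with $r-s\equiv 0\pmod 5$. Then $$2\varphi(q^r)\varphi(q^s)+T_5\big(\varphi(q^r)\varphi(q^s)\big)=4E(q^{2r})E(q^{2s})U(r,4s)U(s,4r),$$ $$2\varphi(q^r)\varphi(q^s)-T_5\big(\varphi(q^r)\varphi(q^s)\big)=4q^rE(q^{2r})E(q^{2s})U(r,s)U(4r,4s).$$
   Context: Let $|q|<1$, $(a;q)_\infty=\prod_{k\ge0}(1-aq^k)$, $(a;q)_n=\prod_{k=0}^{n-1}(1-aq^k)$. $G(q)=\sum_{n\ge0}\frac{q^{n^2}}{(q;q)_n}$, $H(q)=\sum_{n\ge0}\frac{q^{n(n+1)}}{(q;q)_n}$. For positive integers $r,s$, $$U(r,s)=\begin{cases} G(q^r)G(q^s)+q^{(s+r)/5}H(q^r)H(q^s) & \text{if } s+r\equiv0\pmod5,\\ H(q^r)G(q^s)-q^{(s-r)/5}G(q^r)H(q^s) & \text{if } s-r\equiv 0\pmod 5.\end{cases}$$ $\varphi(q)=\sum_{n=-\infty}^\infty q^{n^2}$, $E(q)=(q;q)_\infty$. For a series $\sum a(n)q^n$, $T_5\left(\sum a(n)q^n\right)=\sum\big(a(5n)+a(n/5)\big)q^n$ with $a(k)=0$ for non-integer $k$.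
   Formalization: Adds the hypothesis that 5 does not divide r (hence not s): if 5 divides both, the two cases defining U overlap and the identities fail, e.g. for r=s=5 the left sides have q-coefficient ±4 and the right sides 0. *)

theory Defs
  imports "HOL-Complex_Analysis.Complex_Analysis" "HOL-Number_Theory.Cong"
begin

definition qpoch :: "complex \<Rightarrow> complex \<Rightarrow> nat \<Rightarrow> complex" where
  "qpoch a q n = (\<Prod>k<n. 1 - a * q ^ k)"

definition qpoch_inf :: "complex \<Rightarrow> complex \<Rightarrow> complex" where
  "qpoch_inf a q = (\<Prod>k. 1 - a * q ^ k)"

definition rr_G :: "complex \<Rightarrow> complex" where
  "rr_G q = (\<Sum>n. q ^ (n ^ 2) / qpoch q q n)"

definition rr_H :: "complex \<Rightarrow> complex" where
  "rr_H q = (\<Sum>n. q ^ (n * (n + 1)) / qpoch q q n)"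

definition theta_phi :: "complex \<Rightarrow> complex" where
  "theta_phi q = (\<Sum>\<^sub>\<infinity>n::int. q powi (n ^ 2))"

definition euler_E :: "complex \<Rightarrow> complex" where
  "euler_E q = qpoch_inf q q"

text \<open>
  The exponent \<open>(s - r) / 5\<close> may be negative, hence \<open>powi\<close>. The two cases overlap exactly
  when \<open>5\<close> divides both \<open>r\<close> and \<open>s\<close>; the informal definition is ambiguous there.
\<close>
definition rr_U :: "complex \<Rightarrow> nat \<Rightarrow> nat \<Rightarrow> complex" where
  "rr_U q r s =
     (if [s + r = 0] (mod 5) then
        rr_G (q ^ r) * rr_G (q ^ s) + q ^ ((s + r) div 5) * rr_H (q ^ r) * rr_H (q ^ s)
      else if [s = r] (mod 5) then
        rr_H (q ^ r) * rr_G (q ^ s)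
          - q powi ((int s - int r) div 5) * rr_G (q ^ r) * rr_H (q ^ s)
      else undefined)"

definition T5 :: "'a::comm_monoid_add fps \<Rightarrow> 'a fps" where
  "T5 A = Abs_fps (\<lambda>n. fps_nth A (5 * n) + (if 5 dvd n then fps_nth A (n div 5) else 0))"

end

theory Submission
  imports Defs "HOL-Library.Nat_Bijection"
begin

text \<open>
  Write \<open>G\<^sub>k\<close>, \<open>H\<^sub>k\<close>, \<open>E\<^sub>k\<close> for the values at \<open>q^k\<close>. Expanding \<open>U(r,4s) U(s,4r)\<close> and \<open>U(r,s) U(4r,4s)\<close>
  leaves only products of two Rogers--Ramanujan functions with arguments \<open>x\<close> and \<open>x^4\<close>, where
  \<open>x = q^r\<close> or \<open>x = q^s\<close>, and each of these is a theta series: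
  \<open>2 E\<^sub>2 G\<^sub>1 G\<^sub>4 = \<phi>(q) + \<phi>(q^5)\<close>, \<open>2 q E\<^sub>2 H\<^sub>1 H\<^sub>4 = \<phi>(q) - \<phi>(q^5)\<close>,
  \<open>E\<^sub>2 G\<^sub>1 H\<^sub>4 = \<Sum> q^(5n\<^sup>2 + 4n)\<close> and \<open>E\<^sub>2 H\<^sub>1 G\<^sub>4 = \<Sum> q^(5n\<^sup>2 + 2n)\<close>.
  On the other side, \<open>T5\<close> selects the terms of \<open>\<Sum> q^(r m\<^sup>2 + s n\<^sup>2)\<close> with \<open>m\<^sup>2 + n\<^sup>2\<close> divisible by \<open>5\<close>,
  that is \<open>m = n = 0\<close> or \<open>{m, n} = {\<plusminus>1, \<plusminus>2}\<close> modulo \<open>5\<close>, which yields the same theta series.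

  The last two of the four identities compare infinite products. For the first two,
  \<open>E\<^sub>2 (G\<^sub>1 G\<^sub>4 + q H\<^sub>1 H\<^sub>4) = \<phi>(q)\<close> and \<open>\<phi>(q)\<^sup>2 = \<phi>(q^5)\<^sup>2 + 4 q E\<^sub>2\<^sup>2 G\<^sub>1 H\<^sub>4 H\<^sub>1 G\<^sub>4\<close> both come from
  splitting a double theta series over the cosets of \<open>(2 + i) \<int>[i]\<close>; together they determine
  \<open>E\<^sub>2 (G\<^sub>1 G\<^sub>4 - q H\<^sub>1 H\<^sub>4)\<close> up to a sign, which is fixed by continuity. The sum forms of \<open>G\<close> and \<open>H\<close> are
  turned into products by two steps of the Bailey chain, starting from the unit Bailey pair.
\<close>

section \<open>Infinite sums and \<open>q\<close>-products\<close>

text \<open>Tannery's theorem, transported from series over the naturals by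
  \<open>int_decode\<close>. It carries the finite identities for theta terms to their
  limits.\<close>

lemma infsum_int_dominated_convergence:
  fixes a :: "nat \<Rightarrow> int \<Rightarrow> complex"
  assumes lim: "\<And>k. (\<lambda>n. a n k) \<longlonglongrightarrow> b k"
    and bound: "\<And>n k. norm (a n k) \<le> M k"
    and M: "M summable_on UNIV"
  shows "b summable_on UNIV" and "(\<lambda>n. infsum (a n) UNIV) \<longlonglongrightarrow> infsum b UNIV"
proof -
  have Mnat: "(\<lambda>j. M (int_decode j)) summable_on UNIV"
    using M summable_on_reindex_bij_betw[OF bij_int_decode, of M] by simp
  have bb: "norm (b k) \<le> M k" for k
    by (rule tendsto_upperbound[OF tendsto_norm[OF lim]]) (use bound in auto)
  show "b summable_on UNIV"
    by (rule abs_summable_summable, rule Infinite_Sum.abs_summable_on_comparison_test'[OF M]) (rule bb)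
  have conv: "infsum c UNIV = (\<Sum>j. c (int_decode j))"
    if c: "\<And>k. norm (c k) \<le> M k" for c :: "int \<Rightarrow> complex"
  proof -
    have "c summable_on UNIV"
      by (rule abs_summable_summable, rule Infinite_Sum.abs_summable_on_comparison_test'[OF M]) (rule c)
    then have "(c has_sum infsum c UNIV) UNIV" by simp
    then have "((\<lambda>j. c (int_decode j)) has_sum infsum c UNIV) UNIV"
      using has_sum_reindex_bij_betw[OF bij_int_decode, of c] by simp
    from has_sum_imp_sums[OF this] show ?thesis by (simp add: sums_iff)
  qed
  have "(\<lambda>n. \<Sum>j. a n (int_decode j)) \<longlonglongrightarrow> (\<Sum>j. b (int_decode j))"
    using tannerys_theorem[where a = "\<lambda>j n. a n (int_decode j)" and b = "\<lambda>j. b (int_decode j)"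
        and M = "\<lambda>j. M (int_decode j)" and F = sequentially]
      lim bound summable_on_imp_summable[OF Mnat] by (simp add: case_prod_unfold)
  then show "(\<lambda>n. infsum (a n) UNIV) \<longlonglongrightarrow> infsum b UNIV"
    using conv bound bb by simp
qed

text \<open>Summability of complex families is absolute, so the double sum converges and may be
  iterated.\<close>

lemma
  fixes f :: "'a \<Rightarrow> complex" and g :: "'b \<Rightarrow> complex"
  assumes "f summable_on A" and "g summable_on B"
  shows summable_on_Times: "(\<lambda>(x, y). f x * g y) summable_on A \<times> B"
    and infsum_Times: "infsum (\<lambda>(x, y). f x * g y) (A \<times> B) = infsum f A * infsum g B"
proof -
  have "(\<lambda>x. norm (f x)) summable_on A" "(\<lambda>y. norm (g y)) summable_on B"
    using assms by (simp_all add: summable_on_iff_abs_summable_on_complex)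
  then have "(\<lambda>p. norm ((\<lambda>(x, y). f x * g y) p)) summable_on A \<times> B"
    by (subst Infinite_Sum.abs_summable_on_Sigma_iff)
      (auto simp: norm_mult infsum_cmult_right' abs_mult infsum_nonneg
        intro!: summable_on_cmult_left summable_on_cmult_right)
  then show *: "(\<lambda>(x, y). f x * g y) summable_on A \<times> B"
    by (rule abs_summable_summable)
  show "infsum (\<lambda>(x, y). f x * g y) (A \<times> B) = infsum f A * infsum g B"
    by (subst infsum_Sigma'_banach[symmetric, OF *])
      (simp add: infsum_cmult_right' infsum_cmult_left')
qed

text \<open>Serves to cut a lattice sum into finitely many cosets: \<open>p\<close> names a coset
  and \<open>h p\<close> parametrises it.\<close>

lemma infsum_finite_dissection:
  fixes F :: "'a \<Rightarrow> complex"
  assumes "finite P" and bij: "bij_betw (\<lambda>(p, x). h p x) (P \<times> UNIV) I" and F: "F summable_on I"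
  shows "infsum F I = (\<Sum>p\<in>P. infsum (\<lambda>x. F (h p x)) UNIV)"
proof -
  have s: "(\<lambda>(p, x). F (h p x)) summable_on P \<times> UNIV"
    using F summable_on_reindex_bij_betw[OF bij, of F] by (simp add: case_prod_unfold)
  have "infsum F I = infsum (\<lambda>(p, x). F (h p x)) (P \<times> UNIV)"
    using infsum_reindex_bij_betw[OF bij, of F] by (simp add: case_prod_unfold)
  also have "\<dots> = infsum (\<lambda>p. infsum (\<lambda>x. F (h p x)) UNIV) P"
    by (rule infsum_Sigma'_banach[symmetric, OF s])
  finally show ?thesis using \<open>finite P\<close> by simp
qed

text \<open>Collecting the terms of equal exponent turns an absolutely convergent sum into a power
  series.\<close>

lemma infsum_power_sums:
  fixes c :: "'a \<Rightarrow> complex" and e :: "'a \<Rightarrow> nat"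
  assumes "(\<lambda>x. c x * q ^ e x) summable_on I"
  shows "(\<lambda>k. infsum c {x \<in> I. e x = k} * q ^ k) sums infsum (\<lambda>x. c x * q ^ e x) I"
proof -
  have bij: "bij_betw snd (SIGMA k:UNIV. {x \<in> I. e x = k}) I"
    by (rule bij_betwI[where g = "\<lambda>x. (e x, x)"]) auto
  have s: "(\<lambda>(k, x). c x * q ^ e x) summable_on (SIGMA k:UNIV. {x \<in> I. e x = k})"
    using assms summable_on_reindex_bij_betw[OF bij, of "\<lambda>x. c x * q ^ e x"]
    by (simp add: case_prod_unfold)
  \<comment> \<open>If \<open>q ^ k = 0\<close>, both sides vanish, whether or not \<open>c\<close>
    is summable on the fibre.\<close>
  have inner: "infsum (\<lambda>x. c x * q ^ e x) {x \<in> I. e x = k} = infsum c {x \<in> I. e x = k} * q ^ k" for k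
    by (subst infsum_cmult_left'[symmetric]) (rule infsum_cong, auto)
  have "infsum (\<lambda>x. c x * q ^ e x) I
      = infsum (\<lambda>(k, x). c x * q ^ e x) (SIGMA k:UNIV. {x \<in> I. e x = k})"
    using infsum_reindex_bij_betw[OF bij, of "\<lambda>x. c x * q ^ e x"] by (simp add: case_prod_unfold)
  also have "\<dots> = infsum (\<lambda>k. infsum c {x \<in> I. e x = k} * q ^ k) UNIV"
    by (subst infsum_Sigma'_banach[symmetric, OF s]) (simp only: inner)
  finally have "((\<lambda>k. infsum c {x \<in> I. e x = k} * q ^ k) has_sum
      infsum (\<lambda>x. c x * q ^ e x) I) UNIV"
    using summable_on_Sigma_banach[OF s] by (simp add: inner)
  then show ?thesis by (rule has_sum_imp_sums)
qed

text \<open>Convergence at all real points of the disc forces radius at least 1. The expansion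
  identifies the coefficients on which \<open>T5\<close> acts; holomorphy supplies the continuity
  that fixes a sign later.\<close>

lemma power_sums_has_fps_expansion:
  fixes F :: "complex \<Rightarrow> complex"
  assumes "\<And>q. norm q < 1 \<Longrightarrow> (\<lambda>k. b k * q ^ k) sums F q"
  shows "F has_fps_expansion Abs_fps b" and "F holomorphic_on ball 0 1"
proof -
  have "conv_radius b \<ge> 1"
  proof (rule conv_radius_geI_ex')
    fix r :: real assume "0 < r" "ereal r < 1"
    then show "summable (\<lambda>n. b n * of_real r ^ n)"
      using assms[of "of_real r"] by (auto simp: sums_iff)
  qed
  then have r: "fps_conv_radius (Abs_fps b) \<ge> 1" by (simp add: fps_conv_radius_def)
  have ev: "eval_fps (Abs_fps b) q = F q" if "norm q < 1" for q
    using assms[OF that] by (simp add: eval_fps_def sums_iff)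
  have "eventually (\<lambda>z. z \<in> ball 0 (1::real)) (nhds (0::complex))"
    by (intro eventually_nhds_in_open) auto
  then have "eventually (\<lambda>z. eval_fps (Abs_fps b) z = F z) (nhds 0)"
    by eventually_elim (use ev in auto)
  moreover have "fps_conv_radius (Abs_fps b) > 0"
    using r by (rule less_le_trans[rotated]) auto
  ultimately show "F has_fps_expansion Abs_fps b" by (simp add: has_fps_expansion_def)
  have "eval_fps (Abs_fps b) holomorphic_on ball 0 1"
    by (rule holomorphic_on_eval_fps) (use r in \<open>auto simp: subset_iff in_eball_iff one_ereal_def intro: less_le_trans[of _ "ereal 1"]\<close>)
  then show "F holomorphic_on ball 0 1"
    by (rule holomorphic_transform) (use ev in auto)
qed

section \<open>Finite and infinite q-products\<close>

lemma qpoch_Suc: "qpoch a q (Suc n) = qpoch a q n * (1 - a * q ^ n)"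
  by (simp add: qpoch_def)

lemma qpoch_0 [simp]: "qpoch a q 0 = 1"
  by (simp add: qpoch_def)

lemma convergent_prod_qpoch:
  fixes a q :: complex
  assumes "norm q < 1"
  shows "convergent_prod (\<lambda>k. 1 - a * q ^ k)"
proof -
  have "summable (\<lambda>k. norm (1 - a * q ^ k - 1))"
    using assms summable_mult[OF summable_geometric[of "norm q"], of "norm a"]
    by (simp add: norm_mult norm_power)
  then show ?thesis
    by (intro abs_convergent_prod_imp_convergent_prod) (simp add: abs_convergent_prod_conv_summable)
qed

lemma qpoch_tendsto:
  assumes "norm q < 1"
  shows "(\<lambda>n. qpoch a q n) \<longlonglongrightarrow> qpoch_inf a q"
  using convergent_prod_LIMSEQ[OF convergent_prod_qpoch[OF assms, of a]]
  unfolding qpoch_def qpoch_inf_def by (simp add: LIMSEQ_lessThan_iff_atMost)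

lemma qpoch_inf_eqI:
  assumes "norm q < 1" and "(\<lambda>n. qpoch a q n) \<longlonglongrightarrow> L"
  shows "qpoch_inf a q = L"
  using LIMSEQ_unique[OF qpoch_tendsto[OF assms(1)] assms(2)] .

lemma qpoch_inf_nonzero:
  assumes "norm q < 1" and "norm a < 1"
  shows "qpoch_inf a q \<noteq> 0"
  unfolding qpoch_inf_def
proof (rule prodinf_nonzero[OF convergent_prod_qpoch[OF assms(1)]])
  fix i
  have "norm (a * q ^ i) \<le> norm a * 1"
    unfolding norm_mult norm_power using assms by (intro mult_left_mono power_le_one) auto
  then show "1 - a * q ^ i \<noteq> 0" using assms(2) by auto
qed

text \<open>The factors are sorted by their index modulo \<open>k\<close>.\<close>

lemma qpoch_mult_length: "qpoch a q (k * n) = (\<Prod>i<k. qpoch (a * q ^ i) (q ^ k) n)"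
proof (induction n)
  case (Suc n)
  have "qpoch a q (k * n + m) = qpoch a q (k * n) * (\<Prod>i<m. 1 - a * q ^ i * (q ^ k) ^ n)" for m
    by (induction m) (simp_all add: qpoch_Suc power_add power_mult mult_ac)
  from this[of k] show ?case
    by (simp add: Suc.IH qpoch_Suc prod.distrib add.commute)
qed simp

lemma qpoch_inf_dissect:
  assumes "norm q < 1" and "k > 0"
  shows "qpoch_inf a q = (\<Prod>i<k. qpoch_inf (a * q ^ i) (q ^ k))"
proof -
  have qk: "norm (q ^ k) < 1"
    using assms by (simp add: norm_power power_less_one_iff)
  have "filterlim (\<lambda>n. k * n) at_top sequentially"
    using assms(2) by (simp add: mult.commute[of k] mult_nat_right_at_top)
  then have "(\<lambda>n. qpoch a q (k * n)) \<longlonglongrightarrow> qpoch_inf a q"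
    by (rule filterlim_compose[OF qpoch_tendsto[OF assms(1)]])
  moreover have "(\<lambda>n. qpoch a q (k * n)) \<longlonglongrightarrow> (\<Prod>i<k. qpoch_inf (a * q ^ i) (q ^ k))"
    unfolding qpoch_mult_length by (intro tendsto_prod qpoch_tendsto qk)
  ultimately show ?thesis by (rule LIMSEQ_unique)
qed

lemma qpoch_inf_mult_minus:
  assumes "norm q < 1"
  shows "qpoch_inf a q * qpoch_inf (- a) q = qpoch_inf (a\<^sup>2) (q\<^sup>2)"
proof (rule qpoch_inf_eqI[symmetric])
  have "qpoch a q n * qpoch (- a) q n = qpoch (a\<^sup>2) (q\<^sup>2) n" for n
    unfolding qpoch_def prod.distrib[symmetric]
    by (intro prod.cong refl) (simp add: power2_eq_square power_mult_distrib algebra_simps)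
  then show "(\<lambda>n. qpoch (a\<^sup>2) (q\<^sup>2) n) \<longlonglongrightarrow> qpoch_inf a q * qpoch_inf (- a) q"
    using tendsto_mult[OF qpoch_tendsto[OF assms, of a] qpoch_tendsto[OF assms, of "- a"]] by simp
qed (use assms in \<open>simp add: norm_power power_less_one_iff\<close>)

text \<open>With the value \<open>0\<close> at negative integers, the recurrence of \<open>1 / (q; q)\<^sub>k\<close> holds for all integers \<open>k\<close>.\<close>
definition inv_qfact :: "complex \<Rightarrow> int \<Rightarrow> complex" where
  "inv_qfact q k = (if k < 0 then 0 else 1 / qpoch q q (nat k))"

lemma inv_qfact_neg [simp]: "k < 0 \<Longrightarrow> inv_qfact q k = 0"
  by (simp add: inv_qfact_def)

lemma inv_qfact_0 [simp]: "inv_qfact q 0 = 1"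
  by (simp add: inv_qfact_def)

lemma inv_qfact_of_nat: "inv_qfact q (int n) = 1 / qpoch q q n"
  by (simp add: inv_qfact_def)

lemma qpoch_self_nonzero:
  assumes "norm q < 1"
  shows "qpoch q q n \<noteq> 0"
proof -
  have "norm (q * q ^ k) < 1" for k
    using assms power_less_one_iff[of "norm q" "Suc k"] by (simp add: norm_mult norm_power)
  then have "1 - q * q ^ k \<noteq> 0" for k by (metis eq_iff_diff_eq_0 less_irrefl norm_one)
  then show ?thesis by (simp add: qpoch_def)
qed

lemma inv_qfact_rec:
  assumes "norm q < 1"
  shows "inv_qfact q (k - 1) = (1 - q powi k) * inv_qfact q k"
proof (cases "k > 0")
  case True
  then obtain n where "k = int (Suc n)" using zero_less_imp_eq_int gr0_implies_Suc by metis
  then have k: "k = int (Suc n)" "k - 1 = int n" by auto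
  have "q powi k = q * q ^ n" unfolding k(1) by (subst power_int_of_nat) simp
  then show ?thesis
    unfolding k(2) unfolding k(1) inv_qfact_of_nat
    using qpoch_self_nonzero[OF assms, of "Suc n"] by (simp add: qpoch_Suc divide_simps)
next
  case False
  \<comment> \<open>At \<open>k = 0\<close> the factor \<open>1 - q powi k\<close> vanishes, in
    agreement with the value 0 at -1.\<close>
  then show ?thesis by (cases "k = 0") auto
qed

lemma inv_qfact_tendsto:
  assumes "norm q < 1"
  shows "(\<lambda>n. inv_qfact q (int n + c)) \<longlonglongrightarrow> 1 / qpoch_inf q q"
proof -
  have "(\<lambda>n. 1 / qpoch q q n) \<longlonglongrightarrow> 1 / qpoch_inf q q"
    by (intro tendsto_divide tendsto_const qpoch_tendsto qpoch_inf_nonzero assms)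
  moreover have "filterlim (\<lambda>n. nat (int n + c)) at_top sequentially"
  proof -
    have "eventually (\<lambda>n. nat (int n + c) \<ge> Z) sequentially" for Z
      by (rule eventually_sequentiallyI[of "Z + nat \<bar>c\<bar>"]) linarith
    then show ?thesis by (simp add: filterlim_at_top)
  qed
  ultimately have "(\<lambda>n. 1 / qpoch q q (nat (int n + c))) \<longlonglongrightarrow> 1 / qpoch_inf q q"
    by (rule filterlim_compose)
  moreover have "eventually (\<lambda>n. 1 / qpoch q q (nat (int n + c)) = inv_qfact q (int n + c)) sequentially"
    by (rule eventually_sequentiallyI[of "nat \<bar>c\<bar>"]) (auto simp: inv_qfact_def)
  ultimately show ?thesis by (rule Lim_transform_eventually)
qed

text \<open>The constant \<open>C\<close> provides the majorants when finite identities pass to the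
  limit.\<close>

lemma inv_qfact_bounded:
  assumes "norm q < 1"
  obtains C where "C > 0" and "\<And>k. norm (inv_qfact q k) \<le> C"
proof -
  have "(\<lambda>n. inv_qfact q (int n)) \<longlonglongrightarrow> 1 / qpoch_inf q q"
    using inv_qfact_tendsto[OF assms, of 0] by simp
  then have "Bseq (\<lambda>n. inv_qfact q (int n))" by (intro convergent_imp_Bseq) (auto simp: convergent_def)
  then obtain C where C: "C > 0" "\<And>n. norm (inv_qfact q (int n)) \<le> C" by (auto elim: BseqE)
  have "norm (inv_qfact q k) \<le> C" for k
    using C(1) C(2)[of "nat k"] by (cases "k < 0") auto
  with C(1) show ?thesis using that by blast
qed

section \<open>The triple product and the Rogers--Ramanujan identities\<close>

text \<open>General term of the bilateral series in Jacobi's triple product, normalised so that the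
  product starts with \<open>qpoch_inf z q\<close>.\<close>

definition theta_term :: "complex \<Rightarrow> complex \<Rightarrow> int \<Rightarrow> complex" where
  "theta_term q z r = (- z) powi r * q powi (r * (r - 1) div 2)"

lemma triangle_step: "(r + 1) * r div 2 = r * (r - 1) div 2 + r" for r :: int
proof -
  have "(r + 1) * r = r * (r - 1) + r * 2" by (simp add: algebra_simps)
  then show ?thesis by simp
qed

lemma theta_term_0 [simp]: "theta_term q z 0 = 1"
  by (simp add: theta_term_def)

lemma theta_term_step:
  assumes "q \<noteq> 0" and "z \<noteq> 0"
  shows "theta_term q z (r + 1) = theta_term q z r * (- z) * q powi r"
  using assms unfolding theta_term_def
  by (simp add: triangle_step power_int_add)

text \<open>Reflection exchanges \<open>z\<close> with \<open>q / z\<close>; the negative half of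
  the series is thus a positive half with another parameter.\<close>

lemma theta_term_minus:
  assumes "q \<noteq> 0" and "z \<noteq> 0"
  shows "theta_term q z (- r) = theta_term q (q / z) r"
proof -
  have "(- r) * (- r - 1) div 2 = r * (r - 1) div 2 + r"
    using triangle_step[of r] by (simp add: algebra_simps)
  moreover have "(- (q / z)) powi r = (- z) powi (- r) * q powi r"
    using assms by (simp add: power_int_minus power_int_divide_distrib field_simps
        flip: power_int_mult_distrib)
  ultimately show ?thesis
    using assms unfolding theta_term_def by (simp add: power_int_add)
qed

lemma has_sum_int_shift:
  fixes f :: "int \<Rightarrow> complex"
  assumes "(f has_sum S) UNIV"
  shows "((\<lambda>r. f (r + c)) has_sum S) UNIV"
proof -
  have "bij (\<lambda>r. r + c)" by (rule bij_betwI[where g = "\<lambda>r. r - c"]) auto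
  from has_sum_reindex_bij_betw[OF this, of f S] assms show ?thesis by simp
qed

lemma has_sum_cancel:
  fixes f :: "'a \<Rightarrow> complex"
  assumes "((\<lambda>x. w * f x) has_sum w * S) A" and "w \<noteq> 0"
  shows "(f has_sum S) A"
  using has_sum_cmult_right[OF assms(1), of "inverse w"] assms(2)
  by (simp add: mult.assoc[symmetric])

lemma powi_self_ne_1:
  assumes "norm (q::complex) < 1" and "n > 0"
  shows "1 - q powi n \<noteq> 0"
proof -
  have "norm (q ^ nat n) < 1"
    using assms by (simp add: norm_power power_less_one_iff)
  then show ?thesis using assms(2) by (auto simp: power_int_nonneg_exp)
qed

text \<open>A bilateral form of the q-binomial theorem; only the terms with
  \<open>- N \<le> r \<le> M\<close> are nonzero. Induction on \<open>M\<close> with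
  \<open>N = 0\<close>, then on \<open>N\<close>, each step being a q-Pascal recurrence multiplied
  by \<open>1 - q powi (int (M + N))\<close> for the new values.\<close>

lemma finite_triple_product:
  assumes q: "norm q < 1" "q \<noteq> 0" and z: "z \<noteq> 0"
  shows "((\<lambda>r. theta_term q z r * inv_qfact q (int M - r) * inv_qfact q (int N + r)) has_sum
           inv_qfact q (int (M + N)) * qpoch z q M * qpoch (q / z) q N) UNIV"
    (is "(?T M N has_sum ?S M N) UNIV")
proof -
  have rec: "inv_qfact q (k - 1) = (1 - q powi k) * inv_qfact q k" for k
    by (rule inv_qfact_rec[OF q(1)])
  have cancel: "(?T M' N' has_sum ?S M' N') UNIV"
    if "((\<lambda>r. (1 - q powi (int (M' + N'))) * ?T M' N' r) has_sum (1 - q powi (int (M' + N'))) * ?S M' N') UNIV"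
      and "M' + N' > 0" for M' N'
    by (rule has_sum_cancel[OF that(1)], rule powi_self_ne_1[OF q(1)]) (use that(2) in linarith)
  have base: "(?T 0 0 has_sum ?S 0 0) UNIV"
  proof (rule has_sum_finite_neutralI[where B = "{0}"])
    fix r :: int assume "r \<in> UNIV - {0}"
    then have "r < 0 \<or> - r < 0" by auto
    then show "?T 0 0 r = 0" by auto
  qed auto
  have M0: "(?T M 0 has_sum ?S M 0) UNIV" for M
  proof (induction M)
    case (Suc M)
    \<comment> \<open>Rests on \<open>1 - u * v = (1 - u) + u * (1 - v)\<close> with
      \<open>u = q powi (int M + 1 - r)\<close> and \<open>v = q powi r\<close>: each summand lowers
      the index of one \<open>inv_qfact\<close>.\<close>
    have eq: "(1 - q powi (int (Suc M + 0))) * ?T (Suc M) 0 r = ?T M 0 r + (- z * q ^ M) * ?T M 0 (r - 1)" for r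
    proof -
      have t: "theta_term q z r * q powi (int M + 1 - r) = theta_term q z (r - 1) * (- z) * q ^ M"
      proof -
        have "q powi (r - 1) * q powi (int M + 1 - r) = q ^ M"
          using q(2) by (simp flip: power_int_add)
        then show ?thesis using theta_term_step[OF q(2) z, of "r - 1"] by (simp add: mult.assoc)
      qed
      have a: "inv_qfact q (int M - r) = (1 - q powi (int M + 1 - r)) * inv_qfact q (int M + 1 - r)"
        using rec[of "int M + 1 - r"] by (simp add: algebra_simps)
      have b: "inv_qfact q (r - 1) = (1 - q powi r) * inv_qfact q r" by (rule rec)
      have c: "q powi (int M + 1) = q powi (int M + 1 - r) * q powi r"
        using q(2) by (simp flip: power_int_add)
      have "?T M 0 r + (- z * q ^ M) * ?T M 0 (r - 1)
        = theta_term q z r * inv_qfact q (int M - r) * inv_qfact q r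
          + (theta_term q z (r - 1) * (- z) * q ^ M) * inv_qfact q (int M + 1 - r) * inv_qfact q (r - 1)"
        by (simp add: algebra_simps)
      also have "\<dots> = (1 - q powi (int M + 1 - r) * q powi r) * theta_term q z r * inv_qfact q (int M + 1 - r) * inv_qfact q r"
        unfolding t[symmetric] a b by (simp add: algebra_simps)
      finally show ?thesis unfolding c[symmetric] by (simp add: algebra_simps)
    qed
    have "((\<lambda>r. ?T M 0 r + (- z * q ^ M) * ?T M 0 (r - 1)) has_sum ?S M 0 + (- z * q ^ M) * ?S M 0) UNIV"
      using has_sum_int_shift[OF Suc.IH, of "-1"] Suc.IH
      by (intro has_sum_add has_sum_cmult_right) simp_all
    also have "?S M 0 + (- z * q ^ M) * ?S M 0 = (1 - q powi (int (Suc M + 0))) * ?S (Suc M) 0"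
    proof -
      have "inv_qfact q (int (M + 0)) = (1 - q powi (int (Suc M + 0))) * inv_qfact q (int (Suc M + 0))"
        using rec[of "int (Suc M)"] by simp
      then show ?thesis by (simp only: qpoch_Suc) (simp add: algebra_simps)
    qed
    finally show ?case unfolding eq[symmetric] by (rule cancel) simp
  qed (rule base)
  show ?thesis
  proof (induction N)
    case (Suc N)
    \<comment> \<open>The same splitting with \<open>u = q powi (int N + 1 + r)\<close> and
      \<open>v = q powi (int M - r)\<close>.\<close>
    have eq: "(1 - q powi (int (M + Suc N))) * ?T M (Suc N) r
        = ?T M N r + (- (q / z) * q ^ N) * ?T M N (r + 1)" for r
    proof -
      have t: "theta_term q z r * q powi (int N + 1 + r) = (- (q / z) * q ^ N) * theta_term q z (r + 1)"
        using theta_term_step[OF q(2) z, of r] q(2) z by (simp add: power_int_add field_simps)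
      have a: "inv_qfact q (int N + r) = (1 - q powi (int N + 1 + r)) * inv_qfact q (int N + 1 + r)"
        using rec[of "int N + 1 + r"] by (simp add: algebra_simps)
      have b: "inv_qfact q (int M - (r + 1)) = (1 - q powi (int M - r)) * inv_qfact q (int M - r)"
        using rec[of "int M - r"] by (simp add: algebra_simps)
      have c: "q powi (int (M + Suc N)) = q powi (int N + 1 + r) * q powi (int M - r)"
        using q(2) by (simp add: algebra_simps flip: power_int_add)
      have "?T M N r + (- (q / z) * q ^ N) * ?T M N (r + 1)
        = theta_term q z r * inv_qfact q (int M - r) * inv_qfact q (int N + r)
          + ((- (q / z) * q ^ N) * theta_term q z (r + 1)) * inv_qfact q (int M - (r + 1)) * inv_qfact q (int N + 1 + r)"
        by (simp add: algebra_simps)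
      also have "\<dots> = (1 - q powi (int N + 1 + r) * q powi (int M - r)) * theta_term q z r
          * inv_qfact q (int M - r) * inv_qfact q (int N + 1 + r)"
        unfolding t[symmetric] a b by (simp add: algebra_simps)
      finally show ?thesis unfolding c[symmetric] by (simp add: algebra_simps)
    qed
    have "((\<lambda>r. ?T M N r + (- (q / z) * q ^ N) * ?T M N (r + 1)) has_sum
        ?S M N + (- (q / z) * q ^ N) * ?S M N) UNIV"
      using has_sum_int_shift[OF Suc.IH, of 1] Suc.IH
      by (intro has_sum_add has_sum_cmult_right) simp_all
    also have "?S M N + (- (q / z) * q ^ N) * ?S M N = (1 - q powi (int (M + Suc N))) * ?S M (Suc N)"
    proof -
      have "inv_qfact q (int (M + N)) = (1 - q powi (int (M + Suc N))) * inv_qfact q (int (M + Suc N))"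
        using rec[of "int (M + Suc N)"] by simp
      moreover have "x * a * b + (- u * v) * (x * a * b) = w * (y * a * (b * (1 - u * v)))"
        if "x = w * y" for x y a b u v w :: complex
        unfolding that by (simp add: algebra_simps)
      ultimately show ?thesis unfolding qpoch_Suc by blast
    qed
    finally show ?case unfolding eq[symmetric] by (rule cancel) simp
  qed (rule M0)
qed

text \<open>Ratio test: consecutive terms have the ratio \<open>- z * q ^ n\<close>, which tends to
  0.\<close>

lemma summable_theta_term_nat:
  assumes q: "norm q < 1" "q \<noteq> 0" and z: "z \<noteq> 0"
  shows "summable (\<lambda>n. norm (theta_term q z (int n)))"
proof -
  have "(\<lambda>n. norm z * norm q ^ n) \<longlonglongrightarrow> norm z * 0"
    using q by (intro tendsto_mult tendsto_const LIMSEQ_power_zero) auto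
  then have "eventually (\<lambda>n. norm z * norm q ^ n < 1 / 2) sequentially"
    by (intro order_tendstoD(2)) auto
  then obtain n0 where n0: "\<And>n. n \<ge> n0 \<Longrightarrow> norm z * norm q ^ n < 1 / 2"
    by (auto simp: eventually_sequentially)
  show ?thesis
  proof (rule summable_ratio_test[where c = "1 / 2" and N = n0])
    fix n assume "n \<ge> n0"
    have "norm (theta_term q z (int (Suc n))) = norm (theta_term q z (int n)) * (norm z * norm q ^ n)"
      using theta_term_step[OF q(2) z, of "int n"] by (simp add: norm_mult norm_power add.commute)
    also have "\<dots> \<le> norm (theta_term q z (int n)) * (1 / 2)"
      using n0[OF \<open>n \<ge> n0\<close>] by (intro mult_left_mono) auto
    finally show "norm (norm (theta_term q z (int (Suc n)))) \<le> 1 / 2 * norm (norm (theta_term q z (int n)))"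
      by simp
  qed auto
qed

lemma summable_theta_term:
  assumes q: "norm q < 1" "q \<noteq> 0" and z: "z \<noteq> 0"
  shows "(\<lambda>r. norm (theta_term q z r)) summable_on UNIV"
proof -
  have s: "(\<lambda>n. norm (theta_term q w (int n))) summable_on UNIV" if "w \<noteq> 0" for w
    by (rule summable_nonneg_imp_summable_on) (use summable_theta_term_nat[OF q that] in auto)
  have 1: "(\<lambda>r. norm (theta_term q z r)) summable_on range int"
    using s[OF z] by (subst summable_on_reindex) (auto simp: o_def)
  have 2: "(\<lambda>r. norm (theta_term q z r)) summable_on range (\<lambda>n. - int n)"
    using s[of "q / z"] q z by (subst summable_on_reindex) (auto simp: o_def theta_term_minus inj_on_def)
  have "(UNIV :: int set) = range int \<union> range (\<lambda>n. - int n)"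
    using int_cases2 by blast
  with summable_on_union[OF 1 2] show ?thesis by simp
qed

text \<open>Limit of \<open>finite_triple_product\<close> with \<open>M = N = n\<close>; both
  reciprocal q-factorials tend to \<open>1 / E\<close>, and the terms are dominated by
  \<open>C * C\<close> times the theta terms.\<close>

theorem jacobi_triple_product:
  assumes q: "norm q < 1" "q \<noteq> 0" and z: "z \<noteq> 0"
  shows "(theta_term q z has_sum qpoch_inf z q * qpoch_inf (q / z) q * qpoch_inf q q) UNIV"
proof -
  define E where "E = qpoch_inf q q"
  have E: "E \<noteq> 0" unfolding E_def by (rule qpoch_inf_nonzero) (use q in auto)
  obtain C where C: "C > 0" "\<And>k. norm (inv_qfact q k) \<le> C"
    using inv_qfact_bounded[OF q(1)] by blast
  let ?a = "\<lambda>n r. theta_term q z r * (inv_qfact q (int n - r) * inv_qfact q (int n + r))"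
  have lim: "(\<lambda>n. ?a n r) \<longlonglongrightarrow> theta_term q z r * (1 / E * (1 / E))" for r
    using inv_qfact_tendsto[OF q(1), of "- r"] inv_qfact_tendsto[OF q(1), of r]
    unfolding E_def by (intro tendsto_mult tendsto_const) simp_all
  have bound: "norm (?a n r) \<le> norm (theta_term q z r) * (C * C)" for n r
    unfolding norm_mult using C by (intro mult_left_mono mult_mono) (auto intro: less_imp_le)
  have sM: "(\<lambda>r. norm (theta_term q z r) * (C * C)) summable_on UNIV"
    by (intro summable_on_cmult_left summable_theta_term q z)
  note dc = infsum_int_dominated_convergence(2)[of ?a, OF lim bound sM]
  have "infsum (?a n) UNIV = inv_qfact q (int (n + n)) * qpoch z q n * qpoch (q / z) q n" for n
    using finite_triple_product[OF q z, of n n] unfolding mult.assoc by (rule infsumI)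
  moreover have "(\<lambda>n. inv_qfact q (int (n + n)) * qpoch z q n * qpoch (q / z) q n)
      \<longlonglongrightarrow> 1 / E * qpoch_inf z q * qpoch_inf (q / z) q"
  proof (intro tendsto_mult qpoch_tendsto q)
    have "filterlim (\<lambda>n::nat. n + n) at_top sequentially"
      by (rule filterlim_at_top_mono[OF filterlim_ident]) auto
    from filterlim_compose[OF inv_qfact_tendsto[OF q(1), of 0] this]
    show "(\<lambda>n. inv_qfact q (int (n + n))) \<longlonglongrightarrow> 1 / E" by (simp add: E_def)
  qed
  ultimately have "infsum (\<lambda>r. theta_term q z r * (1 / E * (1 / E))) UNIV
      = 1 / E * qpoch_inf z q * qpoch_inf (q / z) q"
    using dc by (auto intro: LIMSEQ_unique)
  then have "infsum (theta_term q z) UNIV * (1 / E * (1 / E)) = 1 / E * qpoch_inf z q * qpoch_inf (q / z) q"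
    by (subst (asm) infsum_cmult_left')
  then have "infsum (theta_term q z) UNIV = qpoch_inf z q * qpoch_inf (q / z) q * E"
    using E by (simp add: field_simps)
  moreover have "theta_term q z summable_on UNIV"
    by (rule abs_summable_summable[OF summable_theta_term[OF q z]])
  ultimately show ?thesis unfolding E_def by (simp add: has_sum_iff)
qed

section \<open>The Bailey chain and the Rogers-Ramanujan identities\<close>

text \<open>A limiting case of the q-Chu-Vandermonde sum. The induction keeps \<open>c\<close>
  arbitrary because the step for \<open>c\<close> uses the cases \<open>c\<close> and
  \<open>c + 1\<close>.\<close>

lemma q_vandermonde_limit:
  assumes q: "norm q < 1" "q \<noteq> 0"
  shows "((\<lambda>m. q powi (m * (m + c)) * inv_qfact q m * inv_qfact q (int N - m) * inv_qfact q (m + c)) has_sum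
           inv_qfact q (int N) * inv_qfact q (int N + c)) UNIV"
    (is "(?T N c has_sum ?S N c) UNIV")
proof (induction N arbitrary: c)
  case 0
  show ?case
  proof (rule has_sum_finite_neutralI[where B = "{0}"])
    fix r :: int assume "r \<in> UNIV - {0}"
    then have "r < 0 \<or> - r < 0" by auto
    then show "?T 0 c r = 0" by auto
  qed auto
next
  case (Suc N)
  have rec: "inv_qfact q (k - 1) = (1 - q powi k) * inv_qfact q k" for k
    by (rule inv_qfact_rec[OF q(1)])
  define w where "w = 1 - q powi (int (Suc N))"
  have w: "w \<noteq> 0" unfolding w_def by (rule powi_self_ne_1[OF q(1)]) simp
  \<comment> \<open>Here \<open>w = (1 - u) + u * (1 - q powi m)\<close> with
    \<open>u = q powi (int N + 1 - m)\<close>.\<close>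
  have eq: "w * ?T (Suc N) c m = ?T N c m + q powi (int N + 1 + c) * ?T N (c + 1) (m - 1)" for m
  proof -
    have a: "inv_qfact q (int N - m) = (1 - q powi (int N + 1 - m)) * inv_qfact q (int N + 1 - m)"
      using rec[of "int N + 1 - m"] by (simp add: algebra_simps)
    have b: "inv_qfact q (m - 1) = (1 - q powi m) * inv_qfact q m" by (rule rec)
    have c: "w = 1 - q powi (int N + 1 - m) * q powi m"
      using q(2) by (simp add: w_def algebra_simps flip: power_int_add)
    have d: "q powi (int N + 1 + c) * q powi ((m - 1) * (m - 1 + (c + 1))) = q powi (int N + 1 - m) * q powi (m * (m + c))"
      using q(2) by (simp add: algebra_simps flip: power_int_add)
    have "?T N c m + q powi (int N + 1 + c) * ?T N (c + 1) (m - 1)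
      = q powi (m * (m + c)) * inv_qfact q m * inv_qfact q (int N - m) * inv_qfact q (m + c)
       + (q powi (int N + 1 + c) * q powi ((m - 1) * (m - 1 + (c + 1)))) * inv_qfact q (m - 1) * inv_qfact q (int N + 1 - m) * inv_qfact q (m + c)"
      by (simp add: algebra_simps)
    also have "\<dots> = (1 - q powi (int N + 1 - m) * q powi m) * (q powi (m * (m + c)) * inv_qfact q m * inv_qfact q (int N + 1 - m) * inv_qfact q (m + c))"
      unfolding d a b by (simp add: algebra_simps)
    finally show ?thesis unfolding c[symmetric] by (simp add: algebra_simps)
  qed
  have "((\<lambda>m. ?T N c m + q powi (int N + 1 + c) * ?T N (c + 1) (m - 1)) has_sum
      ?S N c + q powi (int N + 1 + c) * ?S N (c + 1)) UNIV"
    using has_sum_int_shift[OF Suc.IH[of "c + 1"], of "-1"] Suc.IH[of c]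
    by (intro has_sum_add has_sum_cmult_right) simp_all
  also have "?S N c + q powi (int N + 1 + c) * ?S N (c + 1) = w * ?S (Suc N) c"
  proof -
    have a: "inv_qfact q (int N) = w * inv_qfact q (int (Suc N))"
      using rec[of "int (Suc N)"] by (simp add: w_def)
    have b: "inv_qfact q (int N + c) = (1 - q powi (int N + 1 + c)) * inv_qfact q (int N + 1 + c)"
      using rec[of "int N + 1 + c"] by (simp add: algebra_simps)
    show ?thesis unfolding a b by (simp add: algebra_simps)
  qed
  finally show ?case unfolding eq[symmetric] using w by (rule has_sum_cancel)
qed

text \<open>The substitution \<open>k = m + r\<close> reduces this to
  \<open>q_vandermonde_limit\<close> with \<open>N = n - r\<close> and \<open>c = 2 * r + e\<close>.
  The values 0 and 1 of \<open>e\<close> correspond to Bailey pairs relative to 1 and to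
  \<open>q\<close>.\<close>

lemma bailey_kernel:
  assumes q: "norm q < 1" "q \<noteq> 0" and e: "e \<le> 1"
  shows "(\<Sum>k\<le>n. q ^ (k * (k + e)) * inv_qfact q (int n - int k)
             * (inv_qfact q (int k - r) * inv_qfact q (int k + r + int e)))
         = q powi (r * (r + int e)) * (inv_qfact q (int n - r) * inv_qfact q (int n + r + int e))"
proof (cases "int n < r")
  case True
  then show ?thesis by (auto intro!: sum.neutral)
next
  case False
  define N where "N = nat (int n - r)"
  have N: "int N = int n - r" using False by (simp add: N_def)
  let ?g = "\<lambda>k::int. q powi (k * (k + int e)) * inv_qfact q (int n - k)
             * (inv_qfact q (k - r) * inv_qfact q (k + r + int e))"
  let ?h = "\<lambda>m::int. q powi (m * (m + (2 * r + int e))) * inv_qfact q m * inv_qfact q (int N - m) * inv_qfact q (m + (2 * r + int e))"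
  have "(?h has_sum inv_qfact q (int N) * inv_qfact q (int N + (2 * r + int e))) UNIV"
    by (rule q_vandermonde_limit[OF q])
  from has_sum_cmult_right[OF has_sum_int_shift[OF this, of "- r"], of "q powi (r * (r + int e))"]
  have "((\<lambda>k. q powi (r * (r + int e)) * ?h (k - r)) has_sum
      q powi (r * (r + int e)) * (inv_qfact q (int n - r) * inv_qfact q (int n + r + int e))) UNIV"
    by (simp add: N algebra_simps)
  also have "(\<lambda>k. q powi (r * (r + int e)) * ?h (k - r)) = ?g"
  proof
    fix k
    have "q powi (r * (r + int e)) * q powi ((k - r) * (k - r + (2 * r + int e))) = q powi (k * (k + int e))"
      using q(2) by (simp add: algebra_simps flip: power_int_add)
    then show "q powi (r * (r + int e)) * ?h (k - r) = ?g k"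
      unfolding mult.assoc[symmetric] by (simp add: N algebra_simps)
  qed
  finally have 1: "(?g has_sum q powi (r * (r + int e)) * (inv_qfact q (int n - r) * inv_qfact q (int n + r + int e))) UNIV" .
  have 2: "(?g has_sum (\<Sum>k\<in>int ` {..n}. ?g k)) UNIV"
  proof (rule has_sum_finite_neutralI)
    fix k :: int assume "k \<in> UNIV - int ` {..n}"
    then have "k < 0 \<or> int n < k" by (cases k) auto
    \<comment> \<open>The two arguments add up to \<open>2 * k + e\<close>, which is negative as
      \<open>e \<le> 1\<close>; so the sum over all integers has no terms below 0.\<close>
    moreover have "k - r < 0 \<or> k + r + int e < 0" if "k < 0" using that e by auto
    ultimately show "?g k = 0" by auto
  qed auto
  have "q ^ (k * (k + e)) = q powi (int k * (int k + int e))" for k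
    by (simp flip: of_nat_add of_nat_mult)
  with has_sum_unique[OF 1 2] show ?thesis
    by (simp add: sum.reindex o_def)
qed

lemma has_sum_sum_complex:
  fixes f :: "'b \<Rightarrow> 'a \<Rightarrow> complex"
  assumes "finite B" and "\<And>k. k \<in> B \<Longrightarrow> (f k has_sum S k) A"
  shows "((\<lambda>x. \<Sum>k\<in>B. f k x) has_sum (\<Sum>k\<in>B. S k)) A"
  using assms by (induction B rule: finite_induct) (auto intro!: has_sum_add)

text \<open>One step of the Bailey chain in bilateral form: exchange the two sums and apply
  \<open>bailey_kernel\<close>. The step multiplies \<open>\<alpha> r\<close> by
  \<open>q powi (r * (r + int e))\<close>.\<close>

lemma bailey_lemma:
  assumes q: "norm q < 1" "q \<noteq> 0" and e: "e \<le> 1"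
    and pair: "\<And>k. ((\<lambda>r. \<alpha> r * (inv_qfact q (int k - r) * inv_qfact q (int k + r + int e))) has_sum \<beta> k) UNIV"
  shows "((\<lambda>r. (\<alpha> r * q powi (r * (r + int e))) * (inv_qfact q (int n - r) * inv_qfact q (int n + r + int e)))
           has_sum (\<Sum>k\<le>n. q ^ (k * (k + e)) * inv_qfact q (int n - int k) * \<beta> k)) UNIV"
proof -
  have "((\<lambda>r. \<Sum>k\<le>n. q ^ (k * (k + e)) * inv_qfact q (int n - int k)
             * (\<alpha> r * (inv_qfact q (int k - r) * inv_qfact q (int k + r + int e))))
           has_sum (\<Sum>k\<le>n. q ^ (k * (k + e)) * inv_qfact q (int n - int k) * \<beta> k)) UNIV"
    by (intro has_sum_sum_complex has_sum_cmult_right pair) auto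
  also have "(\<lambda>r. \<Sum>k\<le>n. q ^ (k * (k + e)) * inv_qfact q (int n - int k)
             * (\<alpha> r * (inv_qfact q (int k - r) * inv_qfact q (int k + r + int e))))
      = (\<lambda>r. \<alpha> r * (\<Sum>k\<le>n. q ^ (k * (k + e)) * inv_qfact q (int n - int k)
             * (inv_qfact q (int k - r) * inv_qfact q (int k + r + int e))))"
    by (simp add: sum_distrib_left mult_ac)
  finally show ?thesis unfolding bailey_kernel[OF q e] by (simp only: mult.assoc)
qed

text \<open>The case \<open>z = 1\<close> of the finite triple product, where the factor
  \<open>qpoch 1 q n\<close> vanishes for \<open>n > 0\<close>.\<close>

lemma unit_bailey_pair:
  assumes q: "norm q < 1" "q \<noteq> 0" and e: "e \<le> 1"
  shows "((\<lambda>r. theta_term q 1 r * (inv_qfact q (int n - r) * inv_qfact q (int n + r + int e)))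
           has_sum (if n = 0 then 1 else 0)) UNIV"
proof -
  have "inv_qfact q (int (n + (n + e))) * qpoch 1 q n * qpoch (q / 1) q (n + e) = (if n = 0 then 1 else 0)"
  proof (cases "n = 0")
    case True
    then show ?thesis using qpoch_self_nonzero[OF q(1), of e] by (simp add: inv_qfact_of_nat)
  next
    case False
    then have "qpoch 1 q n = 0" by (auto simp: qpoch_def intro!: bexI[of _ 0])
    with False show ?thesis by simp
  qed
  with finite_triple_product[OF q, of 1 n "n + e"] show ?thesis
    by (simp add: algebra_simps)
qed

text \<open>Two steps of the chain from the unit pair. The first makes \<open>\<beta> n\<close>
  equal to \<open>inv_qfact q (int n)\<close>, the second produces the finite Rogers-Ramanujan
  sum.\<close>

lemma rogers_ramanujan_finite:
  assumes q: "norm q < 1" "q \<noteq> 0" and e: "e \<le> 1"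
  shows "((\<lambda>r. theta_term (q ^ 5) (q ^ (2 + 2 * e)) r * (inv_qfact q (int n - r) * inv_qfact q (int n + r + int e)))
           has_sum (\<Sum>k\<le>n. q ^ (k * (k + e)) * inv_qfact q (int n - int k) * inv_qfact q (int k))) UNIV"
proof -
  let ?B = "\<lambda>k::nat. if k = 0 then 1 else 0 :: complex"
  have s: "(\<Sum>k\<le>n. q ^ (k * (k + e)) * inv_qfact q (int n - int k) * ?B k) = inv_qfact q (int n)" for n
    by (subst sum.remove[of _ 0]) (auto intro!: sum.neutral)
  have 1: "((\<lambda>r. (theta_term q 1 r * q powi (r * (r + int e))) * (inv_qfact q (int n - r) * inv_qfact q (int n + r + int e)))
           has_sum inv_qfact q (int n)) UNIV" for n
    using bailey_lemma[OF q e unit_bailey_pair[OF q e], of n] unfolding s .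
  have "theta_term q 1 r * q powi (r * (r + int e)) * q powi (r * (r + int e)) = theta_term (q ^ 5) (q ^ (2 + 2 * e)) r" for r
  proof -
    have "even (r * (r - 1))" by simp
    then obtain t where t: "r * (r - 1) = 2 * t" by blast
    \<comment> \<open>Two factors \<open>q powi (r * (r + int e))\<close> raise the base of the
      theta term from \<open>q\<close> to \<open>q ^ 5\<close>.\<close>
    have "5 * t + int (2 + 2 * e) * r = t + r * (r + int e) + r * (r + int e)"
      using t by (simp add: algebra_simps)
    then have "q powi (5 * t) * q powi (int (2 + 2 * e) * r) = q powi t * q powi (r * (r + int e)) * q powi (r * (r + int e))"
      unfolding power_int_add[OF disjI1[OF q(2)], symmetric] by (simp only:)
    moreover have "(- (q ^ (2 + 2 * e))) powi r = (- 1) powi r * q powi (int (2 + 2 * e) * r)"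
      using power_int_mult_distrib[of "- 1" "q ^ (2 + 2 * e)" r]
      by (simp only: mult_minus1 power_int_power)
    ultimately show ?thesis
      unfolding theta_term_def t by (simp add: power_int_power mult_ac)
  qed
  with bailey_lemma[OF q e 1, of n] show ?thesis by simp
qed

text \<open>Limit of the finite form; the triple product sums the theta side. The case
  \<open>e = 0\<close> belongs to \<open>rr_G\<close>, the case \<open>e = 1\<close> to
  \<open>rr_H\<close>.\<close>

theorem rogers_ramanujan:
  assumes q: "norm q < 1" "q \<noteq> 0" and e: "e \<le> 1"
  shows "(\<Sum>k. q ^ (k * (k + e)) / qpoch q q k) * qpoch_inf q q
         = qpoch_inf (q ^ (2 + 2 * e)) (q ^ 5) * qpoch_inf (q ^ 5 / q ^ (2 + 2 * e)) (q ^ 5)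
             * qpoch_inf (q ^ 5) (q ^ 5)"
proof -
  define E where "E = qpoch_inf q q"
  define z where "z = q ^ (2 + 2 * e)"
  have E: "E \<noteq> 0" unfolding E_def by (rule qpoch_inf_nonzero) (use q in auto)
  have q5: "norm (q ^ 5) < 1" "q ^ 5 \<noteq> 0" and z: "z \<noteq> 0"
    using q by (auto simp: norm_power power_less_one_iff z_def)
  obtain C where C: "C > 0" "\<And>k. norm (inv_qfact q k) \<le> C"
    using inv_qfact_bounded[OF q(1)] by blast
  let ?a = "\<lambda>n r. theta_term (q ^ 5) z r * (inv_qfact q (int n - r) * inv_qfact q (int n + r + int e))"
  have lim: "(\<lambda>n. ?a n r) \<longlonglongrightarrow> theta_term (q ^ 5) z r * (1 / E * (1 / E))" for r
    using inv_qfact_tendsto[OF q(1), of "- r"] inv_qfact_tendsto[OF q(1), of "r + int e"]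
    unfolding E_def by (intro tendsto_mult tendsto_const) (simp_all add: add.assoc)
  have bound: "norm (?a n r) \<le> norm (theta_term (q ^ 5) z r) * (C * C)" for n r
    unfolding norm_mult using C by (intro mult_left_mono mult_mono) (auto intro: less_imp_le)
  have sM: "(\<lambda>r. norm (theta_term (q ^ 5) z r) * (C * C)) summable_on UNIV"
    by (intro summable_on_cmult_left summable_theta_term q5 z)
  note dc = infsum_int_dominated_convergence(2)[of ?a, OF lim bound sM]
  let ?b = "\<lambda>k n. q ^ (k * (k + e)) * inv_qfact q (int n - int k) * inv_qfact q (int k)"
  have "infsum (?a n) UNIV = (\<Sum>k. ?b k n)" for n
  proof -
    have "infsum (?a n) UNIV = (\<Sum>k\<le>n. ?b k n)"
      using rogers_ramanujan_finite[OF q e, of n] unfolding z_def by (rule infsumI)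
    \<comment> \<open>For \<open>k > n\<close> the factor \<open>inv_qfact q (int n - int k)\<close>
      is 0, so the finite sum is a full series, as Tannery's theorem requires.\<close>
    also have "\<dots> = (\<Sum>k. ?b k n)" by (rule suminf_finite[symmetric]) auto
    finally show ?thesis .
  qed
  moreover have "(\<lambda>n. \<Sum>k. ?b k n) \<longlonglongrightarrow> (\<Sum>k. q ^ (k * (k + e)) * (1 / E) * inv_qfact q (int k))"
  proof -
    have l: "(\<lambda>n. ?b k n) \<longlonglongrightarrow> q ^ (k * (k + e)) * (1 / E) * inv_qfact q (int k)" for k
      using inv_qfact_tendsto[OF q(1), of "- int k"] unfolding E_def
      by (intro tendsto_mult tendsto_const) simp_all
    have b: "norm (?b k n) \<le> norm q ^ k * (C * C)" for k n
    proof -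
      have "norm q ^ (k * (k + e)) \<le> norm q ^ k"
        using q by (intro power_decreasing) (cases k; simp)+
      then show ?thesis
        unfolding norm_mult norm_power mult.assoc using C
        by (intro mult_mono) (auto intro: less_imp_le)
    qed
    have "summable (\<lambda>k. norm q ^ k * (C * C))"
      using q by (intro summable_mult2 summable_geometric) auto
    with tannerys_theorem[where a = ?b and b = "\<lambda>k. q ^ (k * (k + e)) * (1 / E) * inv_qfact q (int k)"
        and M = "\<lambda>k. norm q ^ k * (C * C)" and F = sequentially] l b
    show ?thesis by (simp add: case_prod_unfold)
  qed
  ultimately have "infsum (\<lambda>r. theta_term (q ^ 5) z r * (1 / E * (1 / E))) UNIV
      = (\<Sum>k. q ^ (k * (k + e)) * (1 / E) * inv_qfact q (int k))"
    using dc by (auto intro: LIMSEQ_unique)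
  also have "(\<lambda>k. q ^ (k * (k + e)) * (1 / E) * inv_qfact q (int k)) = (\<lambda>k. q ^ (k * (k + e)) / qpoch q q k / E)"
    by (simp add: inv_qfact_of_nat mult.commute)
  also have "(\<Sum>k. q ^ (k * (k + e)) / qpoch q q k / E) = (\<Sum>k. q ^ (k * (k + e)) / qpoch q q k) / E"
  proof (rule suminf_divide)
    have "summable (\<lambda>k. norm q ^ k * C)"
      using q by (intro summable_mult2 summable_geometric) auto
    then show "summable (\<lambda>k. q ^ (k * (k + e)) / qpoch q q k)"
    proof (rule summable_comparison_test')
      fix k
      have "norm q ^ (k * (k + e)) \<le> norm q ^ k"
        using q by (intro power_decreasing) (cases k; simp)+
      then have "norm q ^ (k * (k + e)) * norm (inv_qfact q (int k)) \<le> norm q ^ k * C"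
        using C by (intro mult_mono) auto
      then show "norm (q ^ (k * (k + e)) / qpoch q q k) \<le> norm q ^ k * C"
        by (simp add: inv_qfact_of_nat norm_divide norm_power)
    qed
  qed
  also have "infsum (\<lambda>r. theta_term (q ^ 5) z r * (1 / E * (1 / E))) UNIV
      = infsum (theta_term (q ^ 5) z) UNIV * (1 / E * (1 / E))"
    by (rule infsum_cmult_left')
  also have "infsum (theta_term (q ^ 5) z) UNIV = qpoch_inf z (q ^ 5) * qpoch_inf (q ^ 5 / z) (q ^ 5) * qpoch_inf (q ^ 5) (q ^ 5)"
    using jacobi_triple_product[OF q5 z] by (rule infsumI)
  finally show ?thesis using E by (simp add: field_simps z_def E_def)
qed

section \<open>Theta series in one variable\<close>

text \<open>
  With \<open>q = p\<^sup>2\<close>, the half-integral exponents \<open>(a n\<^sup>2 + b n) / 2\<close> of the classical series become integral.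
\<close>
definition qtheta :: "complex \<Rightarrow> complex \<Rightarrow> int \<Rightarrow> int \<Rightarrow> complex" where
  "qtheta p c a b = (\<Sum>\<^sub>\<infinity>n::int. c powi n * p powi (a * n\<^sup>2 + b * n))"

text \<open>The triple product with base \<open>p powi (2 * a)\<close> and
  \<open>z = - c * p powi (a + b)\<close>.\<close>

lemma qtheta_has_sum_product:
  assumes p: "norm p < 1" "p \<noteq> 0" and a: "a > 0" and c: "c \<in> {1, - 1}"
  shows "((\<lambda>n. c powi n * p powi (a * n\<^sup>2 + b * n)) has_sum
           qpoch_inf (- c * p powi (a + b)) (p powi (2 * a)) * qpoch_inf (- c * p powi (a - b)) (p powi (2 * a))
             * qpoch_inf (p powi (2 * a)) (p powi (2 * a))) UNIV"
proof -
  define z where "z = - c * p powi (a + b)"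
  define Q where "Q = p powi (2 * a)"
  have Q: "norm Q < 1" "Q \<noteq> 0"
    using p a by (auto simp: Q_def power_int_nonneg_exp norm_power power_less_one_iff)
  have z: "z \<noteq> 0" using p c by (auto simp: z_def)
  have "theta_term Q z = (\<lambda>n. c powi n * p powi (a * n\<^sup>2 + b * n))"
  proof
    fix n :: int
    have "even (n * (n - 1))" by simp
    then obtain t where t: "n * (n - 1) = 2 * t" by blast
    have "(a + b) * n + (2 * a) * t = a * (n * (n - 1)) + (a + b) * n"
      unfolding t by simp
    also have "\<dots> = a * n\<^sup>2 + b * n" by (simp add: algebra_simps power2_eq_square)
    finally have e: "(a + b) * n + (2 * a) * t = a * n\<^sup>2 + b * n" .
    have "theta_term Q z n = c powi n * (p powi ((a + b) * n) * p powi ((2 * a) * t))"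
      unfolding theta_term_def z_def Q_def t by (simp add: power_int_mult_distrib power_int_mult)
    also have "p powi ((a + b) * n) * p powi ((2 * a) * t) = p powi (a * n\<^sup>2 + b * n)"
      unfolding e[symmetric] power_int_add[OF disjI1[OF p(2)]] ..
    finally show "theta_term Q z n = c powi n * p powi (a * n\<^sup>2 + b * n)" .
  qed
  moreover have "Q / z = - c * p powi (a - b)"
  proof -
    have "p powi (2 * a) = p powi (a + b) * p powi (a - b)"
      using p(2) by (simp flip: power_int_add)
    then show ?thesis using p c by (auto simp: z_def Q_def field_simps)
  qed
  ultimately show ?thesis
    using jacobi_triple_product[OF Q z] unfolding Q_def z_def by simp
qed

lemma qtheta_summable:
  fixes p c :: complex
  assumes "norm p < 1" "p \<noteq> 0" "a > 0" "c \<in> {1, - 1}"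
  shows "(\<lambda>n. c powi n * p powi (a * n\<^sup>2 + b * n)) summable_on UNIV"
  using qtheta_has_sum_product[OF assms] by (rule has_sum_imp_summable)

lemma qtheta_product:
  assumes "norm p < 1" "p \<noteq> 0" "a > 0" "c \<in> {1, - 1}"
  shows "qtheta p c a b =
           qpoch_inf (- c * p powi (a + b)) (p powi (2 * a)) * qpoch_inf (- c * p powi (a - b)) (p powi (2 * a))
             * qpoch_inf (p powi (2 * a)) (p powi (2 * a))"
  unfolding qtheta_def using qtheta_has_sum_product[OF assms] by (rule infsumI)

text \<open>Ensures that theta series are power series in \<open>p\<close> with constant term
  1.\<close>

lemma quadratic_exponent_pos:
  fixes a b n :: int
  assumes "\<bar>b\<bar> < a" and "n \<noteq> 0"
  shows "a * n\<^sup>2 + b * n > 0"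
proof -
  have "\<bar>b * n\<bar> \<le> \<bar>b\<bar> * n\<^sup>2"
  proof -
    have "\<bar>n\<bar> * 1 \<le> \<bar>n\<bar> * \<bar>n\<bar>" using assms(2) by (intro mult_left_mono) auto
    then show ?thesis by (simp add: abs_mult power2_eq_square mult_left_mono)
  qed
  moreover have "\<bar>b\<bar> * n\<^sup>2 < a * n\<^sup>2" using assms by simp
  ultimately show ?thesis by linarith
qed

lemma qtheta_0:
  assumes "\<bar>b\<bar> < a"
  shows "qtheta 0 c a b = 1"
proof -
  have "((\<lambda>n. c powi n * 0 powi (a * n\<^sup>2 + b * n)) has_sum 1) UNIV"
  proof (rule has_sum_finite_neutralI[where B = "{0}"])
    fix n :: int assume "n \<in> UNIV - {0}"
    then show "c powi n * 0 powi (a * n\<^sup>2 + b * n) = 0"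
      using quadratic_exponent_pos[OF assms, of n] by simp
  qed auto
  then show ?thesis unfolding qtheta_def by (rule infsumI)
qed

text \<open>In the product form all three parameters have norm below 1.\<close>

lemma qtheta_nonzero:
  assumes p: "norm p < 1" and "\<bar>b\<bar> < a" and c: "c \<in> {1, - 1}"
  shows "qtheta p c a b \<noteq> 0"
proof (cases "p = 0")
  case True
  then show ?thesis using qtheta_0[OF assms(2)] by simp
next
  case False
  have k: "norm (p powi k) < 1" if "k > 0" for k
    using p that by (auto simp: power_int_nonneg_exp norm_power power_less_one_iff)
  have "a > 0" "a + b > 0" "a - b > 0" "2 * a > 0" using assms(2) by auto
  moreover have "norm (- c * p powi k) = norm (p powi k)" for k using c by auto
  ultimately show ?thesis
    using qtheta_product[OF p False _ c, of a b] k by (simp add: qpoch_inf_nonzero del: mult_minus_left)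
qed

lemma qtheta_holomorphic:
  assumes "\<bar>b\<bar> < a" and c: "c \<in> {1, - 1}"
  shows "(\<lambda>p. qtheta p c a b) holomorphic_on ball 0 1"
proof -
  define e where "e n = nat (a * n\<^sup>2 + b * n)" for n :: int
  have e: "a * n\<^sup>2 + b * n = int (e n)" for n
    using quadratic_exponent_pos[OF assms(1), of n] by (cases "n = 0") (auto simp: e_def)
  have s: "(\<lambda>n. c powi n * p ^ e n) summable_on UNIV" if "norm p < 1" for p
  proof (cases "p = 0")
    case True
    have "finite {n \<in> UNIV. c powi n * p ^ e n \<noteq> 0}"
    proof (rule finite_subset)
      show "{n \<in> UNIV. c powi n * p ^ e n \<noteq> 0} \<subseteq> {0}"
        using True quadratic_exponent_pos[OF assms(1)] e by auto (metis not_less_iff_gr_or_eq of_nat_0)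
    qed simp
    then show ?thesis by (rule finite_nonzero_values_imp_summable_on)
  next
    case False
    then show ?thesis using qtheta_summable[OF that False _ c, of a b] assms(1) unfolding e by simp
  qed
  have "(\<lambda>k. infsum (\<lambda>n. c powi n) {n \<in> UNIV. e n = k} * p ^ k) sums qtheta p c a b" if "norm p < 1" for p
    using infsum_power_sums[OF s[OF that]] unfolding qtheta_def e by simp
  then show ?thesis by (rule power_sums_has_fps_expansion(2))
qed

lemma powi_uminus_of_sign:
  assumes "(c::complex) \<in> {1, - 1}"
  shows "c powi (- n) = c powi n"
proof -
  have "inverse c = c" using assms by auto
  then show ?thesis by (simp add: power_int_minus flip: power_int_inverse)
qed

lemma qtheta_minus:
  assumes "c \<in> {1, - 1}"
  shows "qtheta p c a (- b) = qtheta p c a b"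
proof -
  have "qtheta p c a (- b) = infsum (\<lambda>n. c powi (- n) * p powi (a * (- n)\<^sup>2 + - b * (- n))) UNIV"
    unfolding qtheta_def by (rule infsum_reindex_bij_witness[of _ uminus uminus]) auto
  also have "\<dots> = qtheta p c a b"
    unfolding qtheta_def by (simp add: powi_uminus_of_sign[OF assms])
  finally show ?thesis .
qed

text \<open>Reindexing by \<open>n + 1\<close>. Together with \<open>qtheta_minus\<close> it brings
  linear coefficients into a common range.\<close>

lemma qtheta_shift:
  assumes "p \<noteq> 0" and "c \<noteq> 0"
  shows "qtheta p c a b = c * p powi (a + b) * qtheta p c a (b + 2 * a)"
proof -
  have "qtheta p c a b = infsum (\<lambda>n. c powi (n + 1) * p powi (a * (n + 1)\<^sup>2 + b * (n + 1))) UNIV"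
    unfolding qtheta_def by (rule infsum_reindex_bij_witness[of _ "\<lambda>n. n + 1" "\<lambda>n. n - 1"]) auto
  also have "\<dots> = infsum (\<lambda>n. (c * p powi (a + b)) * (c powi n * p powi (a * n\<^sup>2 + (b + 2 * a) * n))) UNIV"
  proof (intro infsum_cong)
    fix n :: int
    have "a * (n + 1)\<^sup>2 + b * (n + 1) = (a + b) + (a * n\<^sup>2 + (b + 2 * a) * n)"
      by (simp add: algebra_simps power2_eq_square)
    then show "c powi (n + 1) * p powi (a * (n + 1)\<^sup>2 + b * (n + 1))
      = (c * p powi (a + b)) * (c powi n * p powi (a * n\<^sup>2 + (b + 2 * a) * n))"
      using assms by (simp only: power_int_add[OF disjI1[OF assms(1)]] power_int_add[OF disjI1[OF assms(2)]]) simp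
  qed
  finally show ?thesis by (simp add: infsum_cmult_right' qtheta_def)
qed

lemma qtheta_power: "qtheta (p ^ k) c a b = qtheta p c (int k * a) (int k * b)"
  unfolding qtheta_def by (simp add: power_int_power algebra_simps)

lemma qtheta_parity_dissect:
  assumes "norm p < 1" "p \<noteq> 0" "a > 0" and c: "c \<in> {1, - 1}"
  shows "qtheta p c a b = qtheta p 1 (4 * a) (2 * b) + c * p powi (a + b) * qtheta p 1 (4 * a) (4 * a + 2 * b)"
proof -
  let ?F = "\<lambda>n::int. c powi n * p powi (a * n\<^sup>2 + b * n)"
  have bij: "bij_betw (\<lambda>(i, j). 2 * j + i) ({0, 1} \<times> UNIV) (UNIV :: int set)"
    by (rule bij_betwI[where g = "\<lambda>n. (n mod 2, n div 2)"]) auto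
  have c2: "c powi (2 * j) = 1" for j using c by (auto simp: power_int_mult)
  have "qtheta p c a b = infsum (\<lambda>j. ?F (2 * j + 0)) UNIV + infsum (\<lambda>j. ?F (2 * j + 1)) UNIV"
    unfolding qtheta_def
    using infsum_finite_dissection[OF _ bij qtheta_summable[OF assms]] by simp
  moreover have "?F (2 * j + 0) = 1 powi j * p powi (4 * a * j\<^sup>2 + 2 * b * j)" for j
    using c2 by (simp add: algebra_simps power2_eq_square)
  moreover have "?F (2 * j + 1) = (c * p powi (a + b)) * (1 powi j * p powi (4 * a * j\<^sup>2 + (4 * a + 2 * b) * j))" for j
  proof -
    have "a * (2 * j + 1)\<^sup>2 + b * (2 * j + 1) = (a + b) + (4 * a * j\<^sup>2 + (4 * a + 2 * b) * j)"
      by (simp add: algebra_simps power2_eq_square)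
    moreover have "c \<noteq> 0" using c by auto
    ultimately show ?thesis
      using c2 by (simp only: power_int_add[OF disjI1[OF assms(2)]] power_int_add[OF disjI1[OF \<open>c \<noteq> 0\<close>]]) simp
  qed
  ultimately show ?thesis by (simp only: infsum_cmult_right' qtheta_def)
qed

text \<open>
  The substitution \<open>k = j + 2 m + t\<close>, \<open>n = m - 2 j\<close> runs through the five cosets of the sublattice
  \<open>(2 + i) \<int>[i]\<close>; it diagonalises the form \<open>k\<^sup>2 + n\<^sup>2\<close> again.
\<close>
lemma qtheta_mult_dissect:
  assumes p: "norm p < 1" "p \<noteq> 0" and a: "a > 0" and c: "c \<in> {1, - 1}"
  shows "qtheta p 1 a b * qtheta p c a 0 =
           (\<Sum>t\<in>{-2..2}. p powi (a * t\<^sup>2 + b * t)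
              * (qtheta p 1 (5 * a) (2 * a * t + b) * qtheta p c (5 * a) (4 * a * t + 2 * b)))"
proof -
  let ?f = "\<lambda>k::int. 1 powi k * p powi (a * k\<^sup>2 + b * k)"
  let ?g = "\<lambda>n::int. c powi n * p powi (a * n\<^sup>2 + 0 * n)"
  let ?h = "\<lambda>t (j, m). (j + 2 * m + t, m - 2 * j) :: int \<times> int"
  have f: "?f summable_on UNIV" and g: "?g summable_on UNIV"
    by (rule qtheta_summable[OF p a], use c in simp)+
  define h0 where "h0 = (\<lambda>(t, x). ?h t x)"
  \<comment> \<open>The inverse substitution: \<open>k - 2 * n = 5 * j + t\<close>, with
    \<open>t\<close> the residue modulo 5 taken in \<open>{-2..2}\<close>.\<close>
  define g0 where "g0 = (\<lambda>(k, n). let t = (k - 2 * n + 2) mod 5 - 2; j = (k - 2 * n - t) div 5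
      in (t, (j, n + 2 * j :: int)))"
  have "bij_betw h0 ({-2..2} \<times> UNIV) (UNIV \<times> UNIV)"
  proof (rule bij_betwI[where g = g0])
    fix x assume "x \<in> {-2..2::int} \<times> (UNIV :: (int \<times> int) set)"
    then obtain t j m where x: "x = (t, (j, m))" "-2 \<le> t" "t \<le> 2" by (cases x) auto
    have "(5 * j + (t + 2)) mod 5 = t + 2" using x(2,3) by simp
    then show "g0 (h0 x) = x"
      using x(1) by (simp add: h0_def g0_def Let_def algebra_simps)
  next
    fix y :: "int \<times> int"
    obtain k n where y: "y = (k, n)" by (cases y)
    define t where "t = (k - 2 * n + 2) mod 5 - 2"
    have "5 dvd (k - 2 * n - t)"
      unfolding t_def by presburger
    then obtain j where j: "k - 2 * n - t = 5 * j" by blast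
    show "h0 (g0 y) = y"
      unfolding y h0_def g0_def using j by (simp add: Let_def flip: t_def)
  qed (auto simp: Let_def g0_def)
  then have bij: "bij_betw (\<lambda>(t, x). ?h t x) ({-2..2} \<times> UNIV) (UNIV \<times> UNIV)"
    by (simp add: h0_def)
  have "qtheta p 1 a b * qtheta p c a 0 = infsum (\<lambda>(k, n). ?f k * ?g n) (UNIV \<times> UNIV)"
    unfolding qtheta_def using infsum_Times[OF f g] by simp
  also have "\<dots> = (\<Sum>t\<in>{-2..2}. infsum (\<lambda>x. case ?h t x of (k, n) \<Rightarrow> ?f k * ?g n) UNIV)"
    by (rule infsum_finite_dissection[OF _ bij summable_on_Times[OF f g]]) simp
  also have "\<dots> = (\<Sum>t\<in>{-2..2}. p powi (a * t\<^sup>2 + b * t)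
              * (qtheta p 1 (5 * a) (2 * a * t + b) * qtheta p c (5 * a) (4 * a * t + 2 * b)))"
  proof (intro sum.cong refl)
    fix t :: int
    let ?f' = "\<lambda>j::int. 1 powi j * p powi (5 * a * j\<^sup>2 + (2 * a * t + b) * j)"
    let ?g' = "\<lambda>m::int. c powi m * p powi (5 * a * m\<^sup>2 + (4 * a * t + 2 * b) * m)"
    have "(case ?h t x of (k, n) \<Rightarrow> ?f k * ?g n) = p powi (a * t\<^sup>2 + b * t) * (case x of (j, m) \<Rightarrow> ?f' j * ?g' m)" for x
    proof -
      obtain j m where x: "x = (j, m)" by (cases x)
      \<comment> \<open>The mixed terms \<open>4 * a * j * m\<close> of the two squares
        cancel.\<close>
      have e: "(a * (j + 2 * m + t)\<^sup>2 + b * (j + 2 * m + t)) + (a * (m - 2 * j)\<^sup>2 + 0 * (m - 2 * j))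
        = (a * t\<^sup>2 + b * t) + ((5 * a * j\<^sup>2 + (2 * a * t + b) * j) + (5 * a * m\<^sup>2 + (4 * a * t + 2 * b) * m))"
        by (simp add: algebra_simps power2_eq_square)
      have "c powi (m - 2 * j) = c powi m"
        using c by (auto simp: power_int_diff power_int_mult)
      moreover have "p powi (a * (j + 2 * m + t)\<^sup>2 + b * (j + 2 * m + t)) * p powi (a * (m - 2 * j)\<^sup>2 + 0 * (m - 2 * j))
        = p powi (a * t\<^sup>2 + b * t) * (p powi (5 * a * j\<^sup>2 + (2 * a * t + b) * j) * p powi (5 * a * m\<^sup>2 + (4 * a * t + 2 * b) * m))"
        unfolding power_int_add[OF disjI1[OF p(2)], symmetric] e ..
      ultimately show ?thesis unfolding x by (simp add: mult_ac)
    qed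
    then have "infsum (\<lambda>x. case ?h t x of (k, n) \<Rightarrow> ?f k * ?g n) UNIV
      = p powi (a * t\<^sup>2 + b * t) * infsum (\<lambda>(j, m). ?f' j * ?g' m) (UNIV \<times> UNIV)"
      by (simp only: infsum_cmult_right' UNIV_Times_UNIV)
    also have "infsum (\<lambda>(j, m). ?f' j * ?g' m) (UNIV \<times> UNIV) = infsum ?f' UNIV * infsum ?g' UNIV"
      by (intro infsum_Times qtheta_summable p) (use a c in auto)
    finally show "infsum (\<lambda>x. case ?h t x of (k, n) \<Rightarrow> ?f k * ?g n) UNIV = p powi (a * t\<^sup>2 + b * t)
              * (qtheta p 1 (5 * a) (2 * a * t + b) * qtheta p c (5 * a) (4 * a * t + 2 * b))"
      unfolding qtheta_def .
  qed
  finally show ?thesis .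
qed

section \<open>Two identities from the five-coset dissection\<close>

lemma sum_int_m2_2: "(\<Sum>t\<in>{-2..2::int}. f t) = f (-2) + f (-1) + f 0 + f 1 + (f 2 :: complex)"
proof -
  have "{-2..2::int} = {-2, -1, 0, 1, 2}" by auto
  then show ?thesis by (simp add: add_ac)
qed

text \<open>Both sides become four products of series with quadratic coefficient 20: the left by
  parity, the right by \<open>qtheta_mult_dissect\<close>, where one of the five cosets contributes
  0.\<close>

lemma rr_theta_combination:
  assumes p: "norm p < 1" "p \<noteq> 0"
  shows "qtheta p (-1) 5 1 * qtheta p (-1) 20 4 + p\<^sup>2 * (qtheta p (-1) 5 3 * qtheta p (-1) 20 12)
         = qtheta p 1 4 2 * qtheta p (-1) 4 0"
proof -
  \<comment> \<open>The odd part has linear coefficient 22; shift and reflection replace it by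
    18.\<close>
  have A: "qtheta p (-1) 5 1 = qtheta p 1 20 2 - p ^ 4 * qtheta p 1 20 18"
    using qtheta_parity_dissect[OF p, of 5 "-1" 1] qtheta_shift[OF p(2), of 1 20 "-18"]
      qtheta_minus[of 1 p 20 18] by (simp add: power_numeral_reduce)
  have B: "qtheta p (-1) 5 3 = qtheta p 1 20 6 - p\<^sup>2 * qtheta p 1 20 14"
    using qtheta_parity_dissect[OF p, of 5 "-1" 3] qtheta_shift[OF p(2), of 1 20 "-14"]
      qtheta_minus[of 1 p 20 14] by (simp add: power_numeral_reduce)
  have A4: "qtheta p (-1) 20 4 = - (p ^ 16) * qtheta p (-1) 20 36"
    using qtheta_shift[OF p(2), of "-1" 20 "-4"] qtheta_minus[of "-1" p 20 4] by simp
  have B4: "qtheta p (-1) 20 12 = - (p ^ 8) * qtheta p (-1) 20 28"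
    using qtheta_shift[OF p(2), of "-1" 20 "-12"] qtheta_minus[of "-1" p 20 12] by simp
  \<comment> \<open>Shift and reflection show the series to be its own negative; this removes the
    coset \<open>t = 1\<close>.\<close>
  have Z: "qtheta p (-1) 20 20 = 0"
    using qtheta_shift[OF p(2), of "-1" 20 "-20"] qtheta_minus[of "-1" p 20 20] by simp
  have m: "qtheta p 1 20 (-6) = qtheta p 1 20 6" "qtheta p 1 20 (-14) = qtheta p 1 20 14"
     "qtheta p (-1) 20 (-12) = qtheta p (-1) 20 12" "qtheta p (-1) 20 (-28) = qtheta p (-1) 20 28"
    using qtheta_minus[of 1 p 20] qtheta_minus[of "-1" p 20] by simp_all
  have "qtheta p 1 4 2 * qtheta p (-1) 4 0
    = p ^ 12 * (qtheta p 1 20 14 * qtheta p (-1) 20 28) + p\<^sup>2 * (qtheta p 1 20 6 * qtheta p (-1) 20 12)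
      + qtheta p 1 20 2 * qtheta p (-1) 20 4 + p ^ 20 * (qtheta p 1 20 18 * qtheta p (-1) 20 36)"
    using qtheta_mult_dissect[OF p, of 4 "-1" 2] by (simp add: sum_int_m2_2 Z m)
  moreover have "p ^ 12 * (qtheta p 1 20 14 * qtheta p (-1) 20 28) = - (p ^ 4) * (qtheta p 1 20 14 * qtheta p (-1) 20 12)"
    unfolding B4 by (simp add: power_numeral_reduce)
  moreover have "p ^ 20 * (qtheta p 1 20 18 * qtheta p (-1) 20 36) = - (p ^ 4) * (qtheta p 1 20 18 * qtheta p (-1) 20 4)"
    unfolding A4 by (simp add: power_numeral_reduce)
  ultimately show ?thesis unfolding A B by (simp add: algebra_simps power_numeral_reduce)
qed

text \<open>In the dissection with \<open>a = 2\<close> and \<open>b = 0\<close>, the coset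
  \<open>t = 0\<close> gives the square on the right, and the other four cosets contribute equally
  once \<open>qtheta_shift\<close> is applied.\<close>

lemma phi_square_theta:
  assumes p: "norm p < 1" "p \<noteq> 0"
  shows "(qtheta p 1 2 0)\<^sup>2 = (qtheta p 1 10 0)\<^sup>2 + 4 * p\<^sup>2 * (qtheta p 1 10 4 * qtheta p 1 10 8)"
proof -
  have m: "qtheta p 1 10 (-b) = qtheta p 1 10 b" for b by (rule qtheta_minus) simp
  have S: "qtheta p 1 10 4 = p ^ 6 * qtheta p 1 10 16"
    using qtheta_shift[OF p(2), of 1 10 "-4"] m by simp
  have "(qtheta p 1 2 0)\<^sup>2 = (qtheta p 1 10 0)\<^sup>2 + 2 * p\<^sup>2 * (qtheta p 1 10 4 * qtheta p 1 10 8)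
     + 2 * (p ^ 8 * (qtheta p 1 10 8 * qtheta p 1 10 16))"
    using qtheta_mult_dissect[OF p, of 2 1 0] m[of 4] m[of 8] m[of 16]
    by (simp add: sum_int_m2_2 power2_eq_square)
  also have "p ^ 8 * (qtheta p 1 10 8 * qtheta p 1 10 16) = p\<^sup>2 * (qtheta p 1 10 4 * qtheta p 1 10 8)"
    unfolding S by (simp add: power_numeral_reduce)
  finally show ?thesis by (simp add: algebra_simps)
qed

section \<open>Products of Rogers--Ramanujan functions\<close>

lemma qpoch_inf_power_split2:
  assumes "norm q < 1" and "m > 0"
  shows "qpoch_inf (q ^ j) (q ^ m) = qpoch_inf (q ^ j) (q ^ (2 * m)) * qpoch_inf (q ^ (j + m)) (q ^ (2 * m))"
proof -
  have "norm (q ^ m) < 1" using assms by (simp add: norm_power power_less_one_iff)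
  from qpoch_inf_dissect[OF this, of 2 "q ^ j"] show ?thesis
    by (simp add: numeral_eq_Suc mult_ac flip: power_mult power_add)
qed

lemma qpoch_inf_power_split5:
  assumes "norm q < 1" and "m > 0"
  shows "qpoch_inf (q ^ j) (q ^ m) = qpoch_inf (q ^ j) (q ^ (5 * m)) * qpoch_inf (q ^ (j + m)) (q ^ (5 * m))
     * qpoch_inf (q ^ (j + 2 * m)) (q ^ (5 * m)) * qpoch_inf (q ^ (j + 3 * m)) (q ^ (5 * m))
     * qpoch_inf (q ^ (j + 4 * m)) (q ^ (5 * m))"
proof -
  have "norm (q ^ m) < 1" using assms by (simp add: norm_power power_less_one_iff)
  from qpoch_inf_dissect[OF this, of 5 "q ^ j"] show ?thesis
    by (simp add: numeral_eq_Suc mult_ac flip: power_mult power_add)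
qed

lemma qpoch_inf_power_mult_minus:
  assumes "norm q < 1" and "m > 0"
  shows "qpoch_inf (q ^ j) (q ^ m) * qpoch_inf (- (q ^ j)) (q ^ m) = qpoch_inf (q ^ (2 * j)) (q ^ (2 * m))"
proof -
  have "norm (q ^ m) < 1" using assms by (simp add: norm_power power_less_one_iff)
  from qpoch_inf_mult_minus[OF this, of "q ^ j"] show ?thesis
    by (simp add: mult.commute flip: power_mult)
qed

lemma qpoch_inf_power_nonzero:
  assumes "norm q < 1" and "m > 0" and "j > 0"
  shows "qpoch_inf (q ^ j) (q ^ m) \<noteq> 0"
  using assms by (intro qpoch_inf_nonzero) (auto simp: norm_power power_less_one_iff)

lemma euler_E_power_nonzero:
  assumes "norm q < 1" and "m > 0"
  shows "euler_E (q ^ m) \<noteq> 0"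
  unfolding euler_E_def using assms by (rule qpoch_inf_power_nonzero) (rule assms)

lemma rr_G_times_euler_E:
  assumes "norm q < 1" "q \<noteq> 0"
  shows "rr_G q * euler_E q = qpoch_inf (q\<^sup>2) (q ^ 5) * qpoch_inf (q ^ 3) (q ^ 5) * qpoch_inf (q ^ 5) (q ^ 5)"
  using rogers_ramanujan[OF assms, of 0] assms(2)
  by (simp add: rr_G_def euler_E_def power2_eq_square power_numeral_reduce)

lemma rr_H_times_euler_E:
  assumes "norm q < 1" "q \<noteq> 0"
  shows "rr_H q * euler_E q = qpoch_inf (q ^ 4) (q ^ 5) * qpoch_inf q (q ^ 5) * qpoch_inf (q ^ 5) (q ^ 5)"
  using rogers_ramanujan[OF assms, of 1] assms(2)
  by (simp add: rr_H_def euler_E_def power_numeral_reduce)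

text \<open>Splitting \<open>euler_E q\<close> modulo 5 cancels the residues 2, 3 and 0 in
  \<open>rr_G_times_euler_E\<close>.\<close>

lemma rr_G_product:
  assumes q: "norm q < 1" "q \<noteq> 0"
  shows "rr_G q * (qpoch_inf q (q ^ 5) * qpoch_inf (q ^ 4) (q ^ 5)) = 1"
proof -
  define x where "x j = qpoch_inf (q ^ j) (q ^ 5)" for j
  have nz: "x j \<noteq> 0" if "j > 0" for j
    unfolding x_def using q that by (intro qpoch_inf_power_nonzero) auto
  have "rr_G q * (x 1 * x 2 * x 3 * x 4 * x 5) = x 2 * x 3 * x 5"
    using rr_G_times_euler_E[OF q] qpoch_inf_power_split5[OF q(1), of 1 1]
    unfolding euler_E_def x_def by (simp del: One_nat_def mult_eq_0_iff mult_cancel_left mult_cancel_right)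
  then have "(rr_G q * (x 1 * x 4)) * (x 2 * x 3 * x 5) = 1 * (x 2 * x 3 * x 5)"
    by (simp add: mult_ac)
  then have "rr_G q * (x 1 * x 4) = 1"
    by (subst (asm) mult_cancel_right) (use nz in auto)
  then show ?thesis by (simp add: x_def)
qed

lemma rr_H_product:
  assumes q: "norm q < 1" "q \<noteq> 0"
  shows "rr_H q * (qpoch_inf (q\<^sup>2) (q ^ 5) * qpoch_inf (q ^ 3) (q ^ 5)) = 1"
proof -
  define x where "x j = qpoch_inf (q ^ j) (q ^ 5)" for j
  have nz: "x j \<noteq> 0" if "j > 0" for j
    unfolding x_def using q that by (intro qpoch_inf_power_nonzero) auto
  have "rr_H q * (x 1 * x 2 * x 3 * x 4 * x 5) = x 4 * x 1 * x 5"
    using rr_H_times_euler_E[OF q] qpoch_inf_power_split5[OF q(1), of 1 1]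
    unfolding euler_E_def x_def by (simp del: One_nat_def mult_eq_0_iff mult_cancel_left mult_cancel_right)
  then have "(rr_H q * (x 2 * x 3)) * (x 1 * x 4 * x 5) = 1 * (x 1 * x 4 * x 5)"
    by (simp add: mult_ac)
  then have "rr_H q * (x 2 * x 3) = 1"
    by (subst (asm) mult_cancel_right) (use nz in auto)
  then show ?thesis by (simp add: x_def)
qed

text \<open>All three factors and the theta series are products. Pairing \<open>x j 10\<close> with
  \<open>y j\<close> gives \<open>x (2 * j) 20\<close>, after which the remaining factors recombine
  to \<open>x 2 2\<close>.\<close>

lemma rr_G_H4:
  assumes q: "norm q < 1" "q \<noteq> 0"
  shows "euler_E (q\<^sup>2) * rr_G q * rr_H (q ^ 4) = qtheta q 1 5 4"
proof -
  define x where "x j m = qpoch_inf (q ^ j) (q ^ m)" for j m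
  define y where "y j = qpoch_inf (- (q ^ j)) (q ^ 10)" for j
  have q4: "norm (q ^ 4) < 1" "q ^ 4 \<noteq> 0" using q by (auto simp: norm_power power_less_one_iff)
  have th: "qtheta q 1 5 4 = y 9 * y 1 * x 10 10"
    using qtheta_product[OF q, of 5 1 4] by (simp add: x_def y_def)
  have G: "rr_G q * (x 1 5 * x 4 5) = 1" using rr_G_product[OF q] by (simp add: x_def)
  have H: "rr_H (q ^ 4) * (x 8 20 * x 12 20) = 1"
    using rr_H_product[OF q4] by (simp add: x_def flip: power_mult)
  have s2: "x j m = x j (2 * m) * x (j + m) (2 * m)" if "m > 0" for j m
    unfolding x_def using qpoch_inf_power_split2[OF q(1) that] .
  have s5: "x 2 2 = x 2 10 * x 4 10 * x 6 10 * x 8 10 * x 10 10"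
    unfolding x_def using qpoch_inf_power_split5[OF q(1), of 2 2] by simp
  have sm: "x j 10 * y j = x (2 * j) 20" for j
    unfolding x_def y_def using qpoch_inf_power_mult_minus[OF q(1), of 10 j] by simp
  have "x 1 5 * x 4 5 * (x 8 20 * x 12 20) * (y 9 * y 1 * x 10 10)
     = (x 1 10 * y 1) * (x 9 10 * y 9) * x 8 20 * x 12 20 * x 4 10 * x 6 10 * x 10 10"
    using s2[of 5 1] s2[of 5 4] by (simp add: mult_ac)
  also have "\<dots> = (x 2 20 * x 12 20) * (x 8 20 * x 18 20) * x 4 10 * x 6 10 * x 10 10"
    unfolding sm by (simp add: mult_ac)
  also have "\<dots> = x 2 2"
    unfolding s5 using s2[of 10 2] s2[of 10 8] by (simp add: mult_ac)
  finally have "x 2 2 * rr_G q * rr_H (q ^ 4) =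
      (rr_G q * (x 1 5 * x 4 5)) * (rr_H (q ^ 4) * (x 8 20 * x 12 20)) * (y 9 * y 1 * x 10 10)"
    by (simp add: mult_ac)
  then show ?thesis unfolding G H th by (simp add: x_def euler_E_def)
qed

lemma rr_H_G4:
  assumes q: "norm q < 1" "q \<noteq> 0"
  shows "euler_E (q\<^sup>2) * rr_H q * rr_G (q ^ 4) = qtheta q 1 5 2"
proof -
  define x where "x j m = qpoch_inf (q ^ j) (q ^ m)" for j m
  define y where "y j = qpoch_inf (- (q ^ j)) (q ^ 10)" for j
  have q4: "norm (q ^ 4) < 1" "q ^ 4 \<noteq> 0" using q by (auto simp: norm_power power_less_one_iff)
  have th: "qtheta q 1 5 2 = y 7 * y 3 * x 10 10"
    using qtheta_product[OF q, of 5 1 2] by (simp add: x_def y_def)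
  have H: "rr_H q * (x 2 5 * x 3 5) = 1" using rr_H_product[OF q] by (simp add: x_def)
  have G: "rr_G (q ^ 4) * (x 4 20 * x 16 20) = 1"
    using rr_G_product[OF q4] by (simp add: x_def flip: power_mult)
  have s2: "x j m = x j (2 * m) * x (j + m) (2 * m)" if "m > 0" for j m
    unfolding x_def using qpoch_inf_power_split2[OF q(1) that] .
  have s5: "x 2 2 = x 2 10 * x 4 10 * x 6 10 * x 8 10 * x 10 10"
    unfolding x_def using qpoch_inf_power_split5[OF q(1), of 2 2] by simp
  have sm: "x j 10 * y j = x (2 * j) 20" for j
    unfolding x_def y_def using qpoch_inf_power_mult_minus[OF q(1), of 10 j] by simp
  have "x 2 5 * x 3 5 * (x 4 20 * x 16 20) * (y 7 * y 3 * x 10 10)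
     = (x 7 10 * y 7) * (x 3 10 * y 3) * x 4 20 * x 16 20 * x 2 10 * x 8 10 * x 10 10"
    using s2[of 5 2] s2[of 5 3] by (simp add: mult_ac)
  also have "\<dots> = (x 4 20 * x 14 20) * (x 6 20 * x 16 20) * x 2 10 * x 8 10 * x 10 10"
    unfolding sm by (simp add: mult_ac)
  also have "\<dots> = x 2 2"
    unfolding s5 using s2[of 10 4] s2[of 10 6] by (simp add: mult_ac)
  finally have "x 2 2 * rr_H q * rr_G (q ^ 4) =
      (rr_H q * (x 2 5 * x 3 5)) * (rr_G (q ^ 4) * (x 4 20 * x 16 20)) * (y 7 * y 3 * x 10 10)"
    by (simp add: mult_ac)
  then show ?thesis unfolding G H th by (simp add: x_def euler_E_def)
qed

text \<open>With \<open>q = p ^ 2\<close>, the series are Ramanujan's psi(q), phi(-q^2) and phi(q),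
  in this order; the identity is a comparison of products modulo 8.\<close>

lemma psi_phi_product:
  assumes p: "norm p < 1" "p \<noteq> 0"
  shows "euler_E (p ^ 4) * (qtheta p 1 4 2 * qtheta p (-1) 4 0)
       = euler_E (p\<^sup>2) * euler_E (p ^ 8) * qtheta p 1 2 0"
proof -
  define x where "x j m = qpoch_inf (p ^ j) (p ^ m)" for j m
  define y where "y j m = qpoch_inf (- (p ^ j)) (p ^ m)" for j m
  have s2: "x j m = x j (2 * m) * x (j + m) (2 * m)" if "m > 0" for j m
    unfolding x_def using qpoch_inf_power_split2[OF p(1) that] .
  have "norm (p ^ 4) < 1" using p by (simp add: norm_power power_less_one_iff)
  moreover have "(\<Prod>i<2::nat. f i) = f 0 * f 1" for f :: "nat \<Rightarrow> complex"
    by (simp add: numeral_2_eq_2)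
  moreover have "- (p\<^sup>2) * (p ^ 4) ^ 0 = - (p\<^sup>2)" "- (p\<^sup>2) * (p ^ 4) ^ 1 = - (p ^ 6)" "(p ^ 4)\<^sup>2 = p ^ 8"
    by (simp_all add: power_numeral_reduce)
  ultimately have y: "y 2 4 = y 2 8 * y 6 8"
    using qpoch_inf_dissect[of "p ^ 4" 2 "- (p\<^sup>2)"] unfolding y_def by (simp only: zero_less_numeral)
  have sm: "x 2 4 * y 2 4 = x 4 8"
    unfolding x_def y_def using qpoch_inf_power_mult_minus[OF p(1), of 4 2] by simp
  have "qtheta p 1 4 2 = y 6 8 * y 2 8 * x 8 8" "qtheta p (-1) 4 0 = x 4 8 * x 4 8 * x 8 8"
     "qtheta p 1 2 0 = y 2 4 * y 2 4 * x 4 4"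
    using qtheta_product[OF p, of 4 1 2] qtheta_product[OF p, of 4 "-1" 0] qtheta_product[OF p, of 2 1 0]
    by (simp_all add: x_def y_def)
  moreover have "euler_E (p ^ 4) = x 4 4" "euler_E (p\<^sup>2) = x 2 2" "euler_E (p ^ 8) = x 8 8"
    by (simp_all add: x_def euler_E_def)
  moreover have "x 4 4 = x 4 8 * x 8 8" "x 2 2 = x 2 4 * x 4 4" using s2[of 4 4] s2[of 2 2] by simp_all
  ultimately show ?thesis using y sm by (simp add: mult_ac) 
qed

section \<open>The combinations of G G and H H\<close>

text \<open>Product forms read backwards through the triple product; the relations at
  \<open>p ^ 8\<close> are those at \<open>p ^ 2\<close> with \<open>p ^ 4\<close> for
  \<open>p\<close>.\<close>

lemma rr_theta_relations:
  assumes p: "norm p < 1" "p \<noteq> 0"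
  shows "rr_G (p\<^sup>2) * euler_E (p\<^sup>2) = qtheta p (-1) 5 1" and "rr_G (p ^ 8) * euler_E (p ^ 8) = qtheta p (-1) 20 4"
    and "rr_H (p\<^sup>2) * euler_E (p\<^sup>2) = qtheta p (-1) 5 3" and "rr_H (p ^ 8) * euler_E (p ^ 8) = qtheta p (-1) 20 12"
proof -
  have G: "rr_G (p\<^sup>2) * euler_E (p\<^sup>2) = qtheta p (-1) 5 1" and H: "rr_H (p\<^sup>2) * euler_E (p\<^sup>2) = qtheta p (-1) 5 3"
    if p: "norm p < 1" "p \<noteq> 0" for p
  proof -
    have p2: "norm (p\<^sup>2) < 1" "p\<^sup>2 \<noteq> 0" using p by (auto simp: norm_power power_less_one_iff)
    show "rr_G (p\<^sup>2) * euler_E (p\<^sup>2) = qtheta p (-1) 5 1"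
      using rr_G_times_euler_E[OF p2] qtheta_product[OF p, of 5 "-1" 1] by (simp flip: power_mult)
    show "rr_H (p\<^sup>2) * euler_E (p\<^sup>2) = qtheta p (-1) 5 3"
      using rr_H_times_euler_E[OF p2] qtheta_product[OF p, of 5 "-1" 3] by (simp flip: power_mult)
  qed
  have p4: "norm (p ^ 4) < 1" "p ^ 4 \<noteq> 0" using p by (auto simp: norm_power power_less_one_iff)
  show "rr_G (p\<^sup>2) * euler_E (p\<^sup>2) = qtheta p (-1) 5 1" "rr_H (p\<^sup>2) * euler_E (p\<^sup>2) = qtheta p (-1) 5 3"
    using G[OF p] H[OF p] by blast+
  show "rr_G (p ^ 8) * euler_E (p ^ 8) = qtheta p (-1) 20 4" "rr_H (p ^ 8) * euler_E (p ^ 8) = qtheta p (-1) 20 12"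
    using G[OF p4] H[OF p4] qtheta_power[of p 4 "-1" 5 1] qtheta_power[of p 4 "-1" 5 3]
    by (simp_all flip: power_mult)
qed

text \<open>After multiplication by the nonzero \<open>?E\<close>, this is
  \<open>rr_theta_combination\<close> followed by \<open>psi_phi_product\<close>.\<close>

lemma rr_plus_combination:
  assumes p: "norm p < 1" "p \<noteq> 0"
  shows "euler_E (p ^ 4) * (rr_G (p\<^sup>2) * rr_G (p ^ 8) + p\<^sup>2 * rr_H (p\<^sup>2) * rr_H (p ^ 8)) = qtheta p 1 2 0"
proof -
  let ?E = "euler_E (p\<^sup>2) * euler_E (p ^ 8)"
  have "?E \<noteq> 0" using p(1) by (simp add: euler_E_power_nonzero)
  have "?E * (euler_E (p ^ 4) * (rr_G (p\<^sup>2) * rr_G (p ^ 8) + p\<^sup>2 * rr_H (p\<^sup>2) * rr_H (p ^ 8)))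
      = euler_E (p ^ 4) * (qtheta p (-1) 5 1 * qtheta p (-1) 20 4 + p\<^sup>2 * (qtheta p (-1) 5 3 * qtheta p (-1) 20 12))"
    unfolding rr_theta_relations[OF p, symmetric] by (simp add: algebra_simps)
  also have "\<dots> = ?E * qtheta p 1 2 0"
    unfolding rr_theta_combination[OF p] psi_phi_product[OF p] ..
  finally show ?thesis using \<open>?E \<noteq> 0\<close> by (simp only: mult_cancel_left) blast
qed

text \<open>From \<open>(A - B)^2 = (A + B)^2 - 4 * A * B\<close>: regrouped, \<open>A * B\<close>
  is the product of the two mixed series that also occurs in
  \<open>phi_square_theta\<close>.\<close>

lemma rr_minus_combination_square:
  assumes p: "norm p < 1" "p \<noteq> 0"
  shows "(euler_E (p ^ 4) * (rr_G (p\<^sup>2) * rr_G (p ^ 8) - p\<^sup>2 * rr_H (p\<^sup>2) * rr_H (p ^ 8)))\<^sup>2 = (qtheta p 1 10 0)\<^sup>2"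
proof -
  have p2: "norm (p\<^sup>2) < 1" "p\<^sup>2 \<noteq> 0" using p by (auto simp: norm_power power_less_one_iff)
  have 1: "euler_E (p ^ 4) * rr_G (p\<^sup>2) * rr_H (p ^ 8) = qtheta p 1 10 8"
    using rr_G_H4[OF p2] qtheta_power[of p 2 1 5 4] by (simp flip: power_mult)
  have 2: "euler_E (p ^ 4) * rr_H (p\<^sup>2) * rr_G (p ^ 8) = qtheta p 1 10 4"
    using rr_H_G4[OF p2] qtheta_power[of p 2 1 5 2] by (simp flip: power_mult)
  have id: "(e * (g * g' - u * h * h'))\<^sup>2 = (e * (g * g' + u * h * h'))\<^sup>2 - 4 * u * ((e * h * g') * (e * g * h'))"
    for e g g' u h h' :: complex by (simp add: power2_eq_square algebra_simps)
  show ?thesis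
    unfolding id rr_plus_combination[OF p] 1 2 phi_square_theta[OF p] by simp
qed

text \<open>
  By the squared identity, the quotient \<open>X / Y\<close> of the theta function forms of both sides is \<open>\<plusminus>1\<close>; it is
  continuous on the unit disc and equals \<open>1\<close> at \<open>0\<close>.
\<close>
lemma rr_minus_combination:
  assumes p: "norm p < 1" "p \<noteq> 0"
  shows "euler_E (p ^ 4) * (rr_G (p\<^sup>2) * rr_G (p ^ 8) - p\<^sup>2 * rr_H (p\<^sup>2) * rr_H (p ^ 8)) = qtheta p 1 10 0"
proof -
  define X where "X p = qtheta p 1 2 0 * (qtheta p (-1) 5 1 * qtheta p (-1) 20 4
      - p\<^sup>2 * (qtheta p (-1) 5 3 * qtheta p (-1) 20 12))" for p
  define Y where "Y p = qtheta p 1 10 0 * (qtheta p 1 4 2 * qtheta p (-1) 4 0)" for p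
  define D where "D p = euler_E (p ^ 4) * (rr_G (p\<^sup>2) * rr_G (p ^ 8) - p\<^sup>2 * rr_H (p\<^sup>2) * rr_H (p ^ 8))" for p
  \<comment> \<open>\<open>X\<close> and \<open>Y\<close> are the two sides of the claim times the
    same nonzero factor, rewritten by theta series alone so that \<open>qtheta_holomorphic\<close>
    covers them up to \<open>p = 0\<close>.\<close>
  have XD: "euler_E (p ^ 4) * X p = euler_E (p\<^sup>2) * euler_E (p ^ 8) * qtheta p 1 2 0 * D p"
    and YD: "euler_E (p ^ 4) * Y p = euler_E (p\<^sup>2) * euler_E (p ^ 8) * qtheta p 1 2 0 * qtheta p 1 10 0"
    if p: "norm p < 1" "p \<noteq> 0" for p
  proof -
    show "euler_E (p ^ 4) * X p = euler_E (p\<^sup>2) * euler_E (p ^ 8) * qtheta p 1 2 0 * D p"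
      unfolding X_def D_def rr_theta_relations[OF p, symmetric] by (simp add: algebra_simps)
    show "euler_E (p ^ 4) * Y p = euler_E (p\<^sup>2) * euler_E (p ^ 8) * qtheta p 1 2 0 * qtheta p 1 10 0"
      unfolding Y_def psi_phi_product[OF p, symmetric] by (simp add: algebra_simps)
  qed
  have Y0: "Y p \<noteq> 0" if "norm p < 1" for p
    unfolding Y_def using that by (simp add: qtheta_nonzero)
  have at0: "X 0 = 1" "Y 0 = 1" by (simp_all add: X_def Y_def qtheta_0)
  have sq: "(X p / Y p)\<^sup>2 = 1" if "norm p < 1" for p
  proof (cases "p = 0")
    case False
    have "(euler_E (p ^ 4) * X p)\<^sup>2 = (euler_E (p ^ 4) * Y p)\<^sup>2"
      unfolding XD[OF that False] YD[OF that False]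
      using rr_minus_combination_square[OF that False] by (simp add: power_mult_distrib D_def)
    then have "(X p)\<^sup>2 = (Y p)\<^sup>2"
      using euler_E_power_nonzero[OF that, of 4] by (simp add: power_mult_distrib)
    then show ?thesis using Y0[OF that] by (simp add: power_divide)
  qed (simp add: at0)
  have "(\<lambda>p. X p / Y p) holomorphic_on ball 0 1"
    using Y0 unfolding X_def Y_def
    by (intro holomorphic_intros qtheta_holomorphic) auto
  then have "continuous_on (ball 0 1) (\<lambda>p. X p / Y p)" by (rule holomorphic_on_imp_continuous_on)
  moreover have "(\<lambda>p. X p / Y p) ` ball 0 1 \<subseteq> {1, - 1}"
  proof (rule image_subsetI)
    fix p :: complex assume "p \<in> ball 0 1"
    then show "X p / Y p \<in> {1, - 1}" using sq[of p] unfolding power2_eq_1_iff by simp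
  qed
  then have "finite ((\<lambda>p. X p / Y p) ` ball 0 1)" by (rule finite_subset) simp
  ultimately have "(\<lambda>p. X p / Y p) constant_on ball 0 1"
    by (intro continuous_finite_range_constant connected_ball)
  then obtain k where k: "\<And>p. norm p < 1 \<Longrightarrow> X p / Y p = k"
    by (auto simp: constant_on_def)
  have "k = 1" using k[of 0] at0 by simp
  then have "X p = Y p" using k[OF p(1)] Y0[OF p(1)] by simp
  then have "euler_E (p\<^sup>2) * euler_E (p ^ 8) * qtheta p 1 2 0 * D p
      = euler_E (p\<^sup>2) * euler_E (p ^ 8) * qtheta p 1 2 0 * qtheta p 1 10 0"
    using XD[OF p] YD[OF p] by metis
  moreover have "euler_E (p\<^sup>2) * euler_E (p ^ 8) * qtheta p 1 2 0 \<noteq> 0"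
    using p by (simp add: euler_E_power_nonzero qtheta_nonzero)
  ultimately show ?thesis unfolding D_def by (simp only: mult_cancel_left) blast
qed

lemma theta_phi_eq_qtheta: "theta_phi q = qtheta q 1 1 0"
  by (simp add: theta_phi_def qtheta_def)

text \<open>Sum and difference of the plus and minus combinations at a square root \<open>p\<close>
  of \<open>q\<close>.\<close>

lemma
  assumes q: "norm q < 1" "q \<noteq> 0"
  shows rr_G_G4: "2 * (euler_E (q\<^sup>2) * rr_G q * rr_G (q ^ 4)) = theta_phi q + theta_phi (q ^ 5)"
    and rr_H_H4: "2 * (q * euler_E (q\<^sup>2) * rr_H q * rr_H (q ^ 4)) = theta_phi q - theta_phi (q ^ 5)"
proof -
  define p where "p = csqrt q"
  have pq: "p\<^sup>2 = q" by (simp add: p_def)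
  have p: "norm p < 1" "p \<noteq> 0"
    using q unfolding pq[symmetric] by (auto simp: norm_power power_less_one_iff)
  have pp: "q\<^sup>2 = p ^ 4" "q ^ 4 = p ^ 8" by (simp_all flip: pq power_mult)
  have "theta_phi q = qtheta p 1 2 0" "theta_phi (q ^ 5) = qtheta p 1 10 0"
    using qtheta_power[of p 2 1 1 0] qtheta_power[of p 10 1 1 0]
    by (simp_all add: theta_phi_eq_qtheta flip: pq power_mult)
  with rr_plus_combination[OF p] rr_minus_combination[OF p]
  show "2 * (euler_E (q\<^sup>2) * rr_G q * rr_G (q ^ 4)) = theta_phi q + theta_phi (q ^ 5)"
    and "2 * (q * euler_E (q\<^sup>2) * rr_H q * rr_H (q ^ 4)) = theta_phi q - theta_phi (q ^ 5)"
    unfolding pp pq by (simp_all add: algebra_simps flip: mult_2)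
qed

section \<open>The operator \<open>T5\<close> on products of theta functions\<close>

text \<open>The exponent is a natural number so that it can index power series coefficients and
  \<open>q = 0\<close> is allowed.\<close>

definition biquad :: "nat \<Rightarrow> nat \<Rightarrow> int \<times> int \<Rightarrow> nat" where
  "biquad r s = (\<lambda>(m, n). nat (int r * m\<^sup>2 + int s * n\<^sup>2))"

lemma int_biquad: "int (biquad r s (m, n)) = int r * m\<^sup>2 + int s * n\<^sup>2"
  by (simp add: biquad_def)

lemma biquad_eq_0_iff:
  assumes "r > 0" and "s > 0"
  shows "biquad r s x = 0 \<longleftrightarrow> x = (0, 0)"
proof (cases x)
  case (Pair m n)
  have "int r * m\<^sup>2 \<ge> 0" "int s * n\<^sup>2 \<ge> 0" by simp_all
  then have "int (biquad r s (m, n)) = 0 \<longleftrightarrow> int r * m\<^sup>2 = 0 \<and> int s * n\<^sup>2 = 0"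
    unfolding int_biquad by linarith
  then show ?thesis using assms Pair by simp
qed

lemma theta_phi_mult_has_sum:
  assumes "r > 0" "s > 0" and q: "norm q < 1"
  shows "((\<lambda>x. q ^ biquad r s x) has_sum theta_phi (q ^ r) * theta_phi (q ^ s)) UNIV"
proof (cases "q = 0")
  case True
  have "(0::complex) ^ biquad r s (0, 0) = 1" by (simp add: biquad_def)
  then have "((\<lambda>x. q ^ biquad r s x) has_sum 1) UNIV"
    using assms(1,2) True
    by (intro has_sum_finite_neutralI[where B = "{(0, 0)}"]) (auto simp: biquad_eq_0_iff)
  then show ?thesis using assms(1,2) True by (simp add: theta_phi_eq_qtheta qtheta_0 zero_power)
next
  case False
  have n: "norm (q ^ k) < 1" "q ^ k \<noteq> 0" if "k > 0" for k
    using q False that by (auto simp: norm_power power_less_one_iff)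
  let ?f = "\<lambda>k n. 1 powi n * (q ^ k) powi (1 * n\<^sup>2 + 0 * n)"
  have s: "?f r summable_on UNIV" "?f s summable_on UNIV"
    by (rule qtheta_summable; use n assms(1,2) in simp)+
  have "?f r m * ?f s n = q ^ biquad r s (m, n)" for m n
  proof -
    have "?f r m * ?f s n = q powi (int r * m\<^sup>2 + int s * n\<^sup>2)"
      using False by (simp add: power_int_power power_int_add)
    then show ?thesis unfolding int_biquad[symmetric] by simp
  qed
  then have eq: "(\<lambda>x. q ^ biquad r s x) = (\<lambda>(m, n). ?f r m * ?f s n)" by auto
  show ?thesis
    unfolding has_sum_iff eq theta_phi_eq_qtheta qtheta_def
    using summable_on_Times[OF s] infsum_Times[OF s] by (simp only: UNIV_Times_UNIV)
qed

text \<open>With \<open>q = w ^ 5\<close>, the terms \<open>a(5n) q^n\<close> are the terms of the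
  double series in \<open>w\<close> with exponent \<open>5n\<close>, and the terms
  \<open>a(n/5) q^n\<close> give the value at \<open>q ^ 5 = w ^ 25\<close>.\<close>

lemma eval_T5_theta_phi_mult:
  assumes rs: "r > 0" "s > 0" and w: "norm w < 1"
  shows "eval_fps (T5 (fps_expansion (\<lambda>x. theta_phi (x ^ r) * theta_phi (x ^ s)) 0)) (w ^ 5)
    = infsum (\<lambda>x. w ^ biquad r s x) {x. 5 dvd biquad r s x}
      + theta_phi (w ^ (25 * r)) * theta_phi (w ^ (25 * s))"
proof -
  define F where "F x = theta_phi (x ^ r) * theta_phi (x ^ s)" for x
  \<comment> \<open>The number of representations of \<open>k\<close> by the form.\<close>
  define b where "b k = (infsum (\<lambda>_. 1) {x \<in> UNIV. biquad r s x = k} :: complex)" for k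
  define q where "q = w ^ 5"
  let ?I = "{x. 5 dvd biquad r s x}"
  have q: "norm q < 1" using w by (simp add: q_def norm_power power_less_one_iff)
  have hs: "((\<lambda>y. x ^ biquad r s y) has_sum F x) UNIV" if "norm x < 1" for x
    unfolding F_def by (rule theta_phi_mult_has_sum[OF rs that])
  have "(\<lambda>k. b k * x ^ k) sums F x" if "norm x < 1" for x
    using infsum_power_sums[of "\<lambda>_. 1" x "biquad r s" UNIV] hs[OF that] unfolding b_def has_sum_iff by simp
  then have "F has_fps_expansion Abs_fps b" by (rule power_sums_has_fps_expansion(1))
  then have F: "fps_expansion F 0 = Abs_fps b" by (rule fps_expansion_eqI)
  have 1: "(\<lambda>n. b (5 * n) * q ^ n) sums infsum (\<lambda>x. w ^ biquad r s x) ?I"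
  proof -
    have eq: "q ^ (biquad r s x div 5) = w ^ biquad r s x" if "x \<in> ?I" for x
      using that by (auto simp: q_def simp flip: power_mult)
    have "(\<lambda>x. w ^ biquad r s x) summable_on ?I"
      by (rule summable_on_subset[OF has_sum_imp_summable[OF hs[OF w]]]) simp
    also have "?this \<longleftrightarrow> (\<lambda>x. 1 * q ^ (biquad r s x div 5)) summable_on ?I"
      by (intro summable_on_cong) (use eq in simp)
    finally have "(\<lambda>x. 1 * q ^ (biquad r s x div 5)) summable_on ?I" .
    from infsum_power_sums[OF this]
    have "(\<lambda>n. infsum (\<lambda>_. 1) {x \<in> ?I. biquad r s x div 5 = n} * q ^ n) sums
        infsum (\<lambda>x. 1 * q ^ (biquad r s x div 5)) ?I" .
    also have "infsum (\<lambda>x. 1 * q ^ (biquad r s x div 5)) ?I = infsum (\<lambda>x. w ^ biquad r s x) ?I"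
      using eq by (intro infsum_cong) auto
    also have "(\<lambda>n. infsum (\<lambda>_. 1) {x \<in> ?I. biquad r s x div 5 = n} * q ^ n) = (\<lambda>n. b (5 * n) * q ^ n)"
    proof
      fix n
      have "{x \<in> ?I. biquad r s x div 5 = n} = {x \<in> UNIV. biquad r s x = 5 * n}" by auto
      then show "infsum (\<lambda>_. 1) {x \<in> ?I. biquad r s x div 5 = n} * q ^ n = b (5 * n) * q ^ n"
        by (simp add: b_def)
    qed
    finally show ?thesis .
  qed
  have 2: "(\<lambda>n. (if 5 dvd n then b (n div 5) else 0) * q ^ n) sums F (q ^ 5)"
  proof -
    have q5: "norm (q ^ 5) < 1" using q by (simp add: norm_power power_less_one_iff)
    have "(\<lambda>x. 1 * q ^ (5 * biquad r s x)) summable_on UNIV"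
      and i: "infsum (\<lambda>x. 1 * q ^ (5 * biquad r s x)) UNIV = F (q ^ 5)"
      using hs[OF q5] by (simp_all add: has_sum_iff power_mult)
    from infsum_power_sums[OF this(1)]
    have "(\<lambda>n. infsum (\<lambda>_. 1) {x \<in> UNIV. 5 * biquad r s x = n} * q ^ n) sums F (q ^ 5)"
      unfolding i .
    also have "(\<lambda>n. infsum (\<lambda>_. 1) {x \<in> UNIV. 5 * biquad r s x = n} * q ^ n)
        = (\<lambda>n. (if 5 dvd n then b (n div 5) else 0) * q ^ n)"
    proof
      fix n
      have "{x \<in> UNIV. 5 * biquad r s x = n} = (if 5 dvd n then {x \<in> UNIV. biquad r s x = n div 5} else {})"
        by auto
      then show "infsum (\<lambda>_. 1) {x \<in> UNIV. 5 * biquad r s x = n} * q ^ n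
          = (if 5 dvd n then b (n div 5) else 0) * q ^ n"
        by (simp add: b_def)
    qed
    finally show ?thesis .
  qed
  have "eval_fps (T5 (fps_expansion F 0)) q = infsum (\<lambda>x. w ^ biquad r s x) ?I + F (q ^ 5)"
    using sums_add[OF 1 2] unfolding F eval_fps_def T5_def by (simp add: sums_iff distrib_right cong: if_cong)
  moreover have "F (q ^ 5) = theta_phi (w ^ (25 * r)) * theta_phi (w ^ (25 * s))"
    by (simp add: F_def q_def flip: power_mult)
  moreover have "F = (\<lambda>x. theta_phi (x ^ r) * theta_phi (x ^ s))" by (simp add: F_def fun_eq_iff)
  ultimately show ?thesis by (simp only: q_def)
qed

text \<open>Modulo 5 the form is \<open>r * (a^2 + b^2)\<close>, and \<open>r\<close> is
  invertible.\<close>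

lemma dvd_5_biquad_iff:
  assumes "[r = s] (mod 5)" and "\<not> 5 dvd r"
  shows "5 dvd biquad r s (5 * m + a, 5 * n + b) \<longleftrightarrow> 5 dvd a\<^sup>2 + b\<^sup>2"
proof -
  have rs: "5 dvd int s - int r"
    using assms(1) by (simp add: cong_int_iff[symmetric] cong_iff_dvd_diff dvd_diff_commute)
  have co: "coprime 5 (int r)"
    using assms(2) by (subst prime_imp_coprime_int) (auto simp: int_dvd_int_iff[of 5, simplified])
  have "5 dvd biquad r s (5 * m + a, 5 * n + b) \<longleftrightarrow> 5 dvd int (biquad r s (5 * m + a, 5 * n + b))"
    by presburger
  also have "int (biquad r s (5 * m + a, 5 * n + b)) =
      int r * (a\<^sup>2 + b\<^sup>2) + (5 * (int r * (5 * m\<^sup>2 + 2 * a * m) + int s * (5 * n\<^sup>2 + 2 * b * n)) + (int s - int r) * b\<^sup>2)"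
    unfolding int_biquad by (simp add: algebra_simps power2_eq_square)
  also have "5 dvd \<dots> \<longleftrightarrow> 5 dvd int r * (a\<^sup>2 + b\<^sup>2)"
    using rs by (intro dvd_add_left_iff dvd_add) auto
  also have "\<dots> \<longleftrightarrow> 5 dvd a\<^sup>2 + b\<^sup>2"
    using co by (rule coprime_dvd_mult_right_iff)
  finally show ?thesis .
qed

text \<open>Nine residue pairs satisfy the divisibility. In each coset the sum factors into two
  theta series.\<close>

lemma infsum_biquad_multiples_of_5:
  assumes rs: "r > 0" "s > 0" and cong: "[r = s] (mod 5)" and nd: "\<not> 5 dvd r"
    and w: "norm w < 1" "w \<noteq> 0"
  defines "x \<equiv> w ^ (5 * r)" and "y \<equiv> w ^ (5 * s)"
  shows "infsum (\<lambda>x. w ^ biquad r s x) {x. 5 dvd biquad r s x}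
    = qtheta x 1 5 0 * qtheta y 1 5 0
      + 4 * w ^ (4 * r + s) * qtheta x 1 5 4 * qtheta y 1 5 2
      + 4 * w ^ (r + 4 * s) * qtheta x 1 5 2 * qtheta y 1 5 4"
proof -
  define P where "P = {(0, 0), (1, 2), (1, -2), (-1, 2), (-1, -2), (2, 1), (2, -1), (-2, 1), (-2, -1) :: int \<times> int}"
  have P: "(a, b) \<in> P \<longleftrightarrow> 5 dvd a\<^sup>2 + b\<^sup>2" if "a \<in> {-2..2}" "b \<in> {-2..2}" for a b
  proof -
    have "a \<in> {-2, -1, 0, 1, 2}" "b \<in> {-2, -1, 0, 1, 2}" using that by auto
    then show ?thesis by (elim insertE emptyE; simp add: P_def)
  qed
  have P2: "a \<in> {-2..2} \<and> b \<in> {-2..2}" if "(a, b) \<in> P" for a b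
    using that by (auto simp: P_def)
  define h :: "(int \<times> int) \<Rightarrow> (int \<times> int) \<Rightarrow> int \<times> int"
    where "h = (\<lambda>(a, b) (m, n). (5 * m + a, 5 * n + b))"
  \<comment> \<open>Balanced remainder, in \<open>{-2..2}\<close>, and the matching quotient modulo
    5.\<close>
  let ?\<rho> = "\<lambda>k::int. (k + 2) mod 5 - 2" and ?\<kappa> = "\<lambda>k::int. (k + 2) div 5"
  let ?I = "{x. 5 dvd biquad r s x}"
  have split: "5 * ?\<kappa> k + ?\<rho> k = k" for k by presburger
  have bij: "bij_betw (\<lambda>(p, x). h p x) (P \<times> UNIV) ?I"
  proof (rule bij_betwI[where g = "\<lambda>(k, l). ((?\<rho> k, ?\<rho> l), (?\<kappa> k, ?\<kappa> l))"])
    show "(\<lambda>(p, x). h p x) \<in> P \<times> UNIV \<rightarrow> ?I"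
    proof clarify
      fix a b m n :: int assume "(a, b) \<in> P"
      then show "5 dvd biquad r s (h (a, b) (m, n))"
        using P[of a b] P2[of a b] dvd_5_biquad_iff[OF cong nd] by (simp add: h_def)
    qed
    show "(\<lambda>(k, l). ((?\<rho> k, ?\<rho> l), (?\<kappa> k, ?\<kappa> l))) \<in> ?I \<rightarrow> P \<times> UNIV"
    proof (rule funcsetI)
      fix z assume "z \<in> ?I"
      then obtain k l where z: "z = (k, l)" "5 dvd biquad r s (k, l)" by (cases z) auto
      then have "5 dvd (?\<rho> k)\<^sup>2 + (?\<rho> l)\<^sup>2"
        using dvd_5_biquad_iff[OF cong nd, of "?\<kappa> k" "?\<rho> k" "?\<kappa> l" "?\<rho> l"] unfolding split by simp
      moreover have "?\<rho> j \<in> {-2..2}" for j by (simp; presburger)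
      ultimately have "(?\<rho> k, ?\<rho> l) \<in> P" using P by blast
      then show "(case z of (k, l) \<Rightarrow> ((?\<rho> k, ?\<rho> l), (?\<kappa> k, ?\<kappa> l))) \<in> P \<times> UNIV"
        by (simp add: z(1))
    qed
    fix z assume "z \<in> P \<times> (UNIV :: (int \<times> int) set)"
    then obtain a b m n where z: "z = ((a, b), (m, n))" "(a, b) \<in> P" by (cases z) auto
    have "?\<rho> (5 * k + c) = c" "?\<kappa> (5 * k + c) = k" if "c \<in> {-2..2}" for k c
      using that by (simp; presburger)+
    then show "(case (case z of (p, x) \<Rightarrow> h p x) of (k, l) \<Rightarrow> ((?\<rho> k, ?\<rho> l), (?\<kappa> k, ?\<kappa> l))) = z"
      using P2[OF z(2)] unfolding z(1) h_def by (simp del: atLeastAtMost_iff)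
  next
    fix z :: "int \<times> int"
    show "(case (case z of (k, l) \<Rightarrow> ((?\<rho> k, ?\<rho> l), (?\<kappa> k, ?\<kappa> l))) of (p, x) \<Rightarrow> h p x) = z"
      by (cases z) (simp only: h_def prod.case split)
  qed
  have s: "(\<lambda>x. w ^ biquad r s x) summable_on ?I"
    by (rule summable_on_subset[OF has_sum_imp_summable[OF theta_phi_mult_has_sum[OF rs w(1)]]]) simp
  define T where "T = (\<lambda>(a, b). w powi (int r * a\<^sup>2 + int s * b\<^sup>2) * (qtheta x 1 5 (2 * a) * qtheta y 1 5 (2 * b)))"
  have nx: "norm x < 1" "x \<noteq> 0" "norm y < 1" "y \<noteq> 0"
    using w rs by (auto simp: x_def y_def norm_power power_less_one_iff)
  have T: "infsum (\<lambda>z. w ^ biquad r s (h p z)) UNIV = T p" for p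
  proof -
    obtain a b where p: "p = (a, b)" by (cases p)
    let ?f = "\<lambda>m::int. 1 powi m * x powi (5 * m\<^sup>2 + 2 * a * m)"
    let ?g = "\<lambda>n::int. 1 powi n * y powi (5 * n\<^sup>2 + 2 * b * n)"
    have "w ^ biquad r s (h p (m, n)) = w powi (int r * a\<^sup>2 + int s * b\<^sup>2) * (?f m * ?g n)" for m n
    proof -
      have "w ^ biquad r s (h p (m, n)) = w powi int (biquad r s (h p (m, n)))" by simp
      also have "int (biquad r s (h p (m, n))) = (int r * a\<^sup>2 + int s * b\<^sup>2)
          + (int (5 * r) * (5 * m\<^sup>2 + 2 * a * m) + int (5 * s) * (5 * n\<^sup>2 + 2 * b * n))"
        unfolding p h_def prod.case int_biquad by (simp add: algebra_simps power2_eq_square)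
      finally show ?thesis
        unfolding power_int_add[OF disjI1[OF w(2)]] x_def y_def by (simp only: power_int_power power_int_1_left mult_1_left)
    qed
    then have "(\<lambda>z. w ^ biquad r s (h p z)) = (\<lambda>z. w powi (int r * a\<^sup>2 + int s * b\<^sup>2) * (case z of (m, n) \<Rightarrow> ?f m * ?g n))"
      by auto
    moreover have "infsum (\<lambda>(m, n). ?f m * ?g n) (UNIV \<times> UNIV) = infsum ?f UNIV * infsum ?g UNIV"
      by (intro infsum_Times qtheta_summable nx) auto
    ultimately show ?thesis
      unfolding p T_def prod.case qtheta_def by (simp only: infsum_cmult_right' UNIV_Times_UNIV)
  qed
  have "finite P" by (simp add: P_def)
  from infsum_finite_dissection[OF this bij s]
  have "infsum (\<lambda>x. w ^ biquad r s x) ?I = sum T P" by (simp only: T)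
  also have "sum T P = T (0, 0) + T (1, 2) + T (1, -2) + T (-1, 2) + T (-1, -2) + T (2, 1) + T (2, -1) + T (-2, 1) + T (-2, -1)"
    by (simp add: P_def add_ac)
  \<comment> \<open>\<open>T\<close> is even in each argument, so the eight nonzero pairs fall into
    two groups of four.\<close>
  also have "\<dots> = T (0, 0) + 4 * T (1, 2) + 4 * T (2, 1)"
    using qtheta_minus[of 1 x 5 2] qtheta_minus[of 1 x 5 4] qtheta_minus[of 1 y 5 2] qtheta_minus[of 1 y 5 4]
    by (simp add: T_def)
  finally show ?thesis
    using w(2) by (simp add: T_def power_int_add power_add power_mult mult_ac flip: power_int_of_nat)
qed

section \<open>Assembly of the two identities\<close>

lemma rr_values_at_0: "rr_G 0 = 1" "rr_H 0 = 1" "euler_E 0 = 1"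
proof -
  have "qpoch 0 0 n = 1" for n by (simp add: qpoch_def)
  then show "rr_G 0 = 1" "rr_H 0 = 1"
    unfolding rr_G_def rr_H_def
    by (subst suminf_finite[where N = "{0}"]; simp)+
  show "euler_E 0 = 1"
    by (simp add: euler_E_def qpoch_inf_def)
qed

text \<open>\<open>T5\<close> acts on formal series, hence the expansion at 0 and the evaluation at
  \<open>q\<close>. The condition \<open>\<not> 5 dvd r\<close> places \<open>rr_U q r s\<close> and
  \<open>rr_U q (4 * r) (4 * s)\<close> in the second case of \<open>rr_U\<close> and makes
  \<open>r\<close> invertible modulo 5.\<close>

theorem theorem1p3:
  fixes r s :: nat and q :: complex
  assumes "r > 0" and "s > 0"
    and "[r = s] (mod 5)"
    and "\<not> 5 dvd r"
    and "norm q < 1"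
  shows "(2 * theta_phi (q ^ r) * theta_phi (q ^ s)
           + eval_fps (T5 (fps_expansion (\<lambda>x. theta_phi (x ^ r) * theta_phi (x ^ s)) 0)) q
         = 4 * euler_E (q ^ (2 * r)) * euler_E (q ^ (2 * s)) * rr_U q r (4 * s) * rr_U q s (4 * r)) \<and>
        (2 * theta_phi (q ^ r) * theta_phi (q ^ s)
           - eval_fps (T5 (fps_expansion (\<lambda>x. theta_phi (x ^ r) * theta_phi (x ^ s)) 0)) q
         = 4 * q ^ r * euler_E (q ^ (2 * r)) * euler_E (q ^ (2 * s))
             * rr_U q r s * rr_U q (4 * r) (4 * s))"
proof -
  define d where "d = (int s - int r) div 5"
  have "5 dvd int s - int r"
    using assms(3) by (simp add: cong_int_iff[symmetric] cong_iff_dvd_diff dvd_diff_commute)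
  then have d: "int s = int r + 5 * d" by (simp add: d_def)
  \<comment> \<open>The exponents in \<open>rr_U q s (4 * r)\<close> and
    \<open>rr_U q r (4 * s)\<close>; in terms of the possibly negative \<open>d\<close> they are
    \<open>r + d\<close> and \<open>r + 4 * d\<close>.\<close>
  define k l where "k = (4 * r + s) div 5" and "l = (4 * s + r) div 5"
  have k: "int k = int r + d" and l: "int l = int r + 4 * d"
    by (simp_all add: k_def l_def zdiv_int d)
  have k5: "4 * r + s = 5 * k" and l5: "4 * s + r = 5 * l"
    using k l d by linarith+
  have c1: "[4 * s + r = 0] (mod 5)" "[4 * r + s = 0] (mod 5)"
    unfolding k5 l5 cong_0_iff by simp_all
  have c2: "\<not> [s + r = 0] (mod 5)" "\<not> [4 * s + 4 * r = 0] (mod 5)"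
  proof -
    have "\<not> 5 dvd int r" using assms(4) by presburger
    then have "\<not> 5 dvd int (s + r)" "\<not> 5 dvd int (4 * s + 4 * r)"
      unfolding of_nat_add of_nat_mult d by presburger+
    then show "\<not> [s + r = 0] (mod 5)" "\<not> [4 * s + 4 * r = 0] (mod 5)"
      unfolding cong_0_iff by presburger+
  qed
  have c3: "[s = r] (mod 5)" "[4 * s = 4 * r] (mod 5)"
    using assms(3) by (auto simp: cong_sym cong_scalar_left)
  have d4: "(int (4 * s) - int (4 * r)) div 5 = 4 * d" using d by simp
  have U1: "rr_U q r (4 * s) = rr_G (q ^ r) * rr_G (q ^ (4 * s)) + q ^ l * rr_H (q ^ r) * rr_H (q ^ (4 * s))"
    and U2: "rr_U q s (4 * r) = rr_G (q ^ s) * rr_G (q ^ (4 * r)) + q ^ k * rr_H (q ^ s) * rr_H (q ^ (4 * r))"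
    using c1 by (simp_all add: rr_U_def k_def l_def)
  have U3: "rr_U q r s = rr_H (q ^ r) * rr_G (q ^ s) - q powi d * rr_G (q ^ r) * rr_H (q ^ s)"
    and U4: "rr_U q (4 * r) (4 * s) = rr_H (q ^ (4 * r)) * rr_G (q ^ (4 * s))
        - q powi (4 * d) * rr_G (q ^ (4 * r)) * rr_H (q ^ (4 * s))"
    using c2 c3 d4 by (simp_all add: rr_U_def d_def)
  define T where "T = eval_fps (T5 (fps_expansion (\<lambda>x. theta_phi (x ^ r) * theta_phi (x ^ s)) 0)) q"
  show ?thesis
  proof (cases "q = 0")
    case True
    have "theta_phi 0 = 1" by (simp add: theta_phi_eq_qtheta qtheta_0)
    \<comment> \<open>\<open>T5\<close> counts the constant coefficient twice. In the second
      identity both sides are then 0, the right one through \<open>q ^ r\<close>.\<close>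
    moreover have "T = 2"
      using True assms(1,2) \<open>theta_phi 0 = 1\<close>
      by (simp add: T_def eval_fps_at_0 T5_def fps_expansion_def zero_power)
    moreover have "k > 0" "l > 0" using k5 l5 assms(1,2) by linarith+
    ultimately show ?thesis
      unfolding U1 U2 T_def[symmetric] using True assms(1,2) by (simp add: rr_values_at_0 zero_power)
  next
    case False
    \<comment> \<open>A fifth root of \<open>q\<close>; in the end \<open>w\<close> occurs only
      through powers of \<open>w ^ 5\<close>, since \<open>4 * r + s = 5 * k\<close> and
      \<open>r + 4 * s = 5 * l\<close>.\<close>
    define w where "w = exp (Ln q / 5)"
    have wq: "w ^ 5 = q"
      using False by (simp add: w_def exp_of_nat_mult[of 5, simplified, symmetric])
    have w: "norm w < 1" "w \<noteq> 0"
      using assms(5) unfolding wq[symmetric] by (auto simp: norm_power power_less_one_iff w_def)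
    define x y where "x = q ^ r" and "y = q ^ s"
    have n: "norm x < 1" "x \<noteq> 0" "norm y < 1" "y \<noteq> 0"
      using assms(1,2,5) False by (auto simp: x_def y_def norm_power power_less_one_iff)
    have pw: "q ^ (2 * r) = x\<^sup>2" "q ^ (2 * s) = y\<^sup>2" "q ^ (4 * r) = x ^ 4" "q ^ (4 * s) = y ^ 4"
      by (simp_all add: x_def y_def mult.commute flip: power_mult)
    have wp: "w ^ (5 * r) = x" "w ^ (5 * s) = y" "w ^ (25 * r) = x ^ 5" "w ^ (25 * s) = y ^ 5"
        "w ^ (4 * r + s) = q ^ k" "w ^ (r + 4 * s) = q ^ l"
      using k5 l5 by (simp_all add: x_def y_def mult_ac add.commute flip: wq power_mult)
    have th: "qtheta z 1 5 0 = theta_phi (z ^ 5)" for z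
      using qtheta_power[of z 5 1 1 0] by (simp add: theta_phi_eq_qtheta)
    have T: "T = 2 * (theta_phi (x ^ 5) * theta_phi (y ^ 5)) + 4 * q ^ k * qtheta x 1 5 4 * qtheta y 1 5 2
        + 4 * q ^ l * qtheta x 1 5 2 * qtheta y 1 5 4"
      using eval_T5_theta_phi_mult[OF assms(1,2) w(1)] infsum_biquad_multiples_of_5[OF assms(1-4) w]
      unfolding wq wp T_def[symmetric] th by simp
    note GG = rr_G_G4[OF n(1,2)] rr_G_G4[OF n(3,4)] and HH = rr_H_H4[OF n(1,2)] rr_H_H4[OF n(3,4)]
    note GH = rr_G_H4[OF n(1,2)] rr_G_H4[OF n(3,4)] and HG = rr_H_G4[OF n(1,2)] rr_H_G4[OF n(3,4)]
    define E E' where "E = euler_E (x\<^sup>2)" and "E' = euler_E (y\<^sup>2)"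
    have "int (k + l) = int (r + s)" using k l d by simp
    then have kl: "q ^ k * q ^ l = x * y"
      unfolding x_def y_def power_add[symmetric] by (simp only: of_nat_eq_iff)
    \<comment> \<open>The prefactor \<open>q ^ r\<close> absorbs the possibly negative exponents of
      \<open>rr_U\<close>.\<close>
    have u: "x * q powi d = q ^ k" "x * q powi (4 * d) = q ^ l" "x * (q powi d * q powi (4 * d)) = y"
    proof -
      have z: "q ^ m = q powi int m" for m by simp
      have "q powi d * q powi (4 * d) = q powi (5 * d)"
        using power_int_add[of q d "4 * d"] False by simp
      then
      show "x * q powi d = q ^ k" "x * q powi (4 * d) = q ^ l" "x * (q powi d * q powi (4 * d)) = y"
        unfolding x_def y_def z k l d by (simp_all add: power_int_add[OF disjI1[OF False]])
    qed
    \<comment> \<open>Each of the four terms is regrouped into a product in \<open>x\<close>,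
      \<open>x ^ 4\<close> times a product in \<open>y\<close>, \<open>y ^ 4\<close>; the last one
      uses \<open>q ^ k * q ^ l = x * y\<close>.\<close>
    have R1: "4 * E * E' * (rr_G x * rr_G (y ^ 4) + q ^ l * rr_H x * rr_H (y ^ 4))
          * (rr_G y * rr_G (x ^ 4) + q ^ k * rr_H y * rr_H (x ^ 4))
        = (2 * (E * rr_G x * rr_G (x ^ 4))) * (2 * (E' * rr_G y * rr_G (y ^ 4)))
          + 4 * q ^ k * (E * rr_G x * rr_H (x ^ 4)) * (E' * rr_H y * rr_G (y ^ 4))
          + 4 * q ^ l * (E * rr_H x * rr_G (x ^ 4)) * (E' * rr_G y * rr_H (y ^ 4))
          + 4 * (q ^ k * q ^ l) * (E * rr_H x * rr_H (x ^ 4)) * (E' * rr_H y * rr_H (y ^ 4))"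
      by (simp add: algebra_simps)
    also have "4 * (q ^ k * q ^ l) * (E * rr_H x * rr_H (x ^ 4)) * (E' * rr_H y * rr_H (y ^ 4))
        = (2 * (x * E * rr_H x * rr_H (x ^ 4))) * (2 * (y * E' * rr_H y * rr_H (y ^ 4)))"
      unfolding kl by (simp add: algebra_simps)
    finally have R1: "4 * E * E' * (rr_G x * rr_G (y ^ 4) + q ^ l * rr_H x * rr_H (y ^ 4))
          * (rr_G y * rr_G (x ^ 4) + q ^ k * rr_H y * rr_H (x ^ 4)) = 2 * theta_phi x * theta_phi y + T"
      unfolding E_def E'_def GG HH GH HG T by (simp add: algebra_simps)
    \<comment> \<open>The mixed terms now carry minus signs, and the outer terms pair a sum with a
      difference of theta functions, which changes the sign of
      \<open>theta_phi (x ^ 5) * theta_phi (y ^ 5)\<close>.\<close>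
    have "4 * x * E * E' * (rr_H x * rr_G y - q powi d * rr_G x * rr_H y)
          * (rr_H (x ^ 4) * rr_G (y ^ 4) - q powi (4 * d) * rr_G (x ^ 4) * rr_H (y ^ 4))
        = (2 * (x * E * rr_H x * rr_H (x ^ 4))) * (2 * (E' * rr_G y * rr_G (y ^ 4)))
          - 4 * (x * q powi d) * (E * rr_G x * rr_H (x ^ 4)) * (E' * rr_H y * rr_G (y ^ 4))
          - 4 * (x * q powi (4 * d)) * (E * rr_H x * rr_G (x ^ 4)) * (E' * rr_G y * rr_H (y ^ 4))
          + (2 * (E * rr_G x * rr_G (x ^ 4))) * (2 * ((x * (q powi d * q powi (4 * d))) * E' * rr_H y * rr_H (y ^ 4)))"
      by (simp add: algebra_simps)
    also have "\<dots> = 2 * theta_phi x * theta_phi y - T"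
      unfolding u E_def E'_def GG HH GH HG T by (simp add: algebra_simps)
    finally show ?thesis
      using R1 unfolding U1 U2 U3 U4 T_def[symmetric] pw x_def[symmetric] y_def[symmetric] E_def E'_def
      by (intro conjI) (simp_all only: mult.assoc)
  qed
qed

end
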